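(* Let $k\ge 0$, let $\Lambda, \Gamma$ be $k$-graphs and let $X$ be a $\Lambda$--$\Gamma$ morph. Then there exists a linking graph for $X$, and this linking graph is unique up to isomorphism (of $(k+1)$-graphs).
   Context: **$k$-graphs.** Let $k\ge 0$ ($\mathbb{N}^0=\{0\}$). A $k$-graph is a nonempty countable small category $\Lambda$ with a functor $d:\Lambda\to\mathbb{N}^k$ satisfying the factorisation property: whenever $d(\lambda)=m+n$ there are unique $\mu,\nu\in\Lambda$ with $d(\mu)=m$, $d(\nu)=n$ and $\lambda=\mu\nu$. Objects are identified with $\Lambda^0=d^{-1}(0)$; $\Lambda^n=d^{-1}(n)$; $r,s:\Lambda\to\Lambda^0$ are the codomain and domain maps. An isomorphism of $k$-graphs is a degree-preserving isomorphism of categories. $e_1,\dots,e_{k+1}$ are the generators of $\mathbb{N}^{k+1}$. **$k$-morphs.** A $\Lambda$--$\Gamma$ morph (or $k$-morph) is a countable set $X$ with maps $r:X\to\Lambda^0$, $s:X\to\Gamma^0$ and a bijection $\phi: X*_{\Gamma^0}\Gamma\to\Lambda*_{\Lambda^0}X$, where $X*_{\Gamma^0}\Gamma=\{(x,\gamma): s(x)=r(\gamma)\}$ and $\Lambda*_{\Lambda^0}X=\{(\lambda,x): s(\lambda)=r(x)\}$, such that whenever $\phi(x_1,\gamma_1)=(\lambda_1,x_2)$: (1) $d(\gamma_1)=d(\lambda_1)$; (2) $s(\gamma_1)=s(x_2)$; (3) $r(\lambda_1)=r(x_1)$; and (4) if also $\phi(x_2,\gamma_2)=(\lambda_2,x_3)$,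 then $\phi(x_1,\gamma_1\gamma_2)=(\lambda_1\lambda_2,x_3)$. $\Lambda$--$\Gamma$ morphs $X,Y$ are isomorphic if there is a bijection $\theta:X\to Y$ intertwining range and source maps with $(\operatorname{id}_\Lambda\times\theta)\circ\phi_X=\phi_Y\circ(\theta\times\operatorname{id}_\Gamma)$. **Linking graphs.** Let $\iota:\mathbb{N}^k\to\mathbb{N}^{k+1}$, $\iota(n)=(n,0)$. Let $\Sigma$ be a $(k+1)$-graph and put $\Sigma^\iota=\bigcup_{n\in\mathbb{N}^k}\Sigma^{\iota(n)}$, regarded as a $k$-graph. Let $i:\Lambda\sqcup\Gamma\to\Sigma$ be an $\iota$-quasimorphism (a functor with $d(i(\lambda))=\iota(d(\lambda))$) inducing an isomorphism of $k$-graphs $\Lambda\sqcup\Gamma\cong\Sigma^\iota$, and suppose every $\alpha\in\Sigma^{e_{k+1}}$ satisfies $s(\alpha)\in i(\Gamma^0)$ and $r(\alpha)\in i(\Lambda^0)$. Then $X(\Lambda,\Gamma,\Sigma,i):=\Sigma^{e_{k+1}}$ is a $\Lambda$--$\Gamma$ morph with $r_X(\alpha)$ the unique $v\in\Lambda^0$ with $i(v)=r(\alpha)$, $s_X(\alpha)$ the unique $w\in\Gamma^0$ with $i(w)=s(\alpha)$, and $\phi_X(\alpha,\gamma)=(\lambda,\alpha')$ where $\lambda\in\Lambda^{d(\gamma)}$, $\alpha'\in\Sigma^{e_{k+1}}$ are the unique elements with $\alpha i(\gamma)=i(\lambda)\alpha'$ in $\Sigma$. The pair $(\Sigma,i)$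 (or simply $\Sigma$) is a *linking graph* for $X$ if $X(\Lambda,\Gamma,\Sigma,i)$ is isomorphic to $X$ as a $\Lambda$--$\Gamma$ morph. *)

theory Defs
  imports "HOL-Library.Function_Algebras" "HOL-Library.Countable_Set"
begin

text \<open>
  \<open>\<nat>\<^sup>k\<close> is modelled as the set of functions \<open>nat \<Rightarrow> nat\<close> supported on the
  coordinates \<open>0, \<dots>, k - 1\<close>, with the pointwise monoid structure. The generators
  are numbered from \<open>0\<close>, so \<open>gen k\<close> is the last generator \<open>e\<^sub>k\<^sub>+\<^sub>1\<close> of \<open>\<nat>\<^sup>k\<^sup>+\<^sup>1\<close>.
\<close>

definition Nat_pow :: "nat \<Rightarrow> (nat \<Rightarrow> nat) set"
  where "Nat_pow k = {n. \<forall>j\<ge>k. n j = 0}"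

definition gen :: "nat \<Rightarrow> nat \<Rightarrow> nat"
  where "gen j = (\<lambda>l. if l = j then 1 else 0)"

definition iota :: "nat \<Rightarrow> (nat \<Rightarrow> nat) \<Rightarrow> nat \<Rightarrow> nat"
  where "iota k n = (\<lambda>j. if j < k then n j else 0)"

section \<open>Small categories and functors\<close>

text \<open>
  Categories are presented by their morphisms only: an object is identified with its
  identity morphism, so codomain and domain are maps from morphisms to morphisms.
  The composite \<open>cmp C f g\<close> is meaningful only when \<open>src C f = rng C g\<close>.
\<close>

record 'a cat =
  mor :: "'a set"
  rng :: "'a \<Rightarrow> 'a"
  src :: "'a \<Rightarrow> 'a"
  cmp :: "'a \<Rightarrow> 'a \<Rightarrow> 'a"

locale small_category =
  fixes C :: "('a, 'm) cat_scheme"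
  assumes rng_mor: "f \<in> mor C \<Longrightarrow> rng C f \<in> mor C"
    and src_mor: "f \<in> mor C \<Longrightarrow> src C f \<in> mor C"
    and rng_rng: "f \<in> mor C \<Longrightarrow> rng C (rng C f) = rng C f"
    and src_rng: "f \<in> mor C \<Longrightarrow> src C (rng C f) = rng C f"
    and rng_src: "f \<in> mor C \<Longrightarrow> rng C (src C f) = src C f"
    and src_src: "f \<in> mor C \<Longrightarrow> src C (src C f) = src C f"
    and cmp_mor: "\<lbrakk>f \<in> mor C; g \<in> mor C; src C f = rng C g\<rbrakk> \<Longrightarrow> cmp C f g \<in> mor C"
    and rng_cmp: "\<lbrakk>f \<in> mor C; g \<in> mor C; src C f = rng C g\<rbrakk> \<Longrightarrow> rng C (cmp C f g) = rng C f"
    and src_cmp: "\<lbrakk>f \<in> mor C; g \<in> mor C; src C f = rng C g\<rbrakk> \<Longrightarrow> src C (cmp C f g) = src C g"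
    and cmp_rng: "f \<in> mor C \<Longrightarrow> cmp C (rng C f) f = f"
    and cmp_src: "f \<in> mor C \<Longrightarrow> cmp C f (src C f) = f"
    and cmp_assoc: "\<lbrakk>f \<in> mor C; g \<in> mor C; h \<in> mor C; src C f = rng C g; src C g = rng C h\<rbrakk>
      \<Longrightarrow> cmp C (cmp C f g) h = cmp C f (cmp C g h)"

definition is_functor :: "('a, 'm) cat_scheme \<Rightarrow> ('b, 'n) cat_scheme \<Rightarrow> ('a \<Rightarrow> 'b) \<Rightarrow> bool"
  where "is_functor C D F \<longleftrightarrow>
    (\<forall>f\<in>mor C. F f \<in> mor D \<and> F (rng C f) = rng D (F f) \<and> F (src C f) = src D (F f)) \<and>
    (\<forall>f\<in>mor C. \<forall>g\<in>mor C. src C f = rng C g \<longrightarrow> F (cmp C f g) = cmp D (F f) (F g))"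

section \<open>Higher-rank graphs\<close>

record 'a graph = "'a cat" +
  deg :: "'a \<Rightarrow> nat \<Rightarrow> nat"

definition grade :: "'a graph \<Rightarrow> (nat \<Rightarrow> nat) \<Rightarrow> 'a set"
  where "grade \<Lambda> n = {\<eta> \<in> mor \<Lambda>. deg \<Lambda> \<eta> = n}"

locale k_graph = small_category \<Lambda>
  for k :: nat and \<Lambda> :: "'a graph" +
  assumes nonempty: "mor \<Lambda> \<noteq> {}"
    and countable_mor: "countable (mor \<Lambda>)"
    and deg_Nat_pow: "\<eta> \<in> mor \<Lambda> \<Longrightarrow> deg \<Lambda> \<eta> \<in> Nat_pow k"
    and deg_rng: "\<eta> \<in> mor \<Lambda> \<Longrightarrow> deg \<Lambda> (rng \<Lambda> \<eta>) = 0"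
    and deg_src: "\<eta> \<in> mor \<Lambda> \<Longrightarrow> deg \<Lambda> (src \<Lambda> \<eta>) = 0"
    and deg_cmp: "\<lbrakk>\<mu> \<in> mor \<Lambda>; \<nu> \<in> mor \<Lambda>; src \<Lambda> \<mu> = rng \<Lambda> \<nu>\<rbrakk>
      \<Longrightarrow> deg \<Lambda> (cmp \<Lambda> \<mu> \<nu>) = deg \<Lambda> \<mu> + deg \<Lambda> \<nu>"
    and factorisation:
      "\<lbrakk>\<eta> \<in> mor \<Lambda>; m \<in> Nat_pow k; n \<in> Nat_pow k; deg \<Lambda> \<eta> = m + n\<rbrakk>
      \<Longrightarrow> \<exists>!(\<mu>, \<nu>). \<mu> \<in> grade \<Lambda> m \<and> \<nu> \<in> grade \<Lambda> n \<and> src \<Lambda> \<mu> = rng \<Lambda> \<nu> \<and> \<eta> = cmp \<Lambda> \<mu> \<nu>"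

text \<open>The identity morphisms (objects) are exactly the morphisms of degree \<open>0\<close>.\<close>

lemma (in k_graph) grade_0_eq: "grade \<Lambda> 0 = {v \<in> mor \<Lambda>. rng \<Lambda> v = v}"
proof (intro equalityI subsetI)
  fix v assume "v \<in> grade \<Lambda> 0"
  then have v: "v \<in> mor \<Lambda>" "deg \<Lambda> v = 0" by (auto simp: grade_def)
  let ?P = "\<lambda>p. case p of (\<mu>, \<nu>) \<Rightarrow> \<mu> \<in> grade \<Lambda> 0 \<and> \<nu> \<in> grade \<Lambda> 0 \<and>
    src \<Lambda> \<mu> = rng \<Lambda> \<nu> \<and> v = cmp \<Lambda> \<mu> \<nu>"
  have "(0 :: nat \<Rightarrow> nat) \<in> Nat_pow k" by (simp add: Nat_pow_def)
  from factorisation[OF v(1) this this] have ex1: "\<exists>!p. ?P p" using v by simp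
  have "?P (rng \<Lambda> v, v)" "?P (v, src \<Lambda> v)"
    using v by (auto simp: grade_def rng_mor src_mor deg_rng deg_src src_rng rng_src cmp_rng cmp_src)
  with ex1 have "(rng \<Lambda> v, v) = (v, src \<Lambda> v)" by blast
  with v show "v \<in> {v \<in> mor \<Lambda>. rng \<Lambda> v = v}" by simp
next
  fix v assume "v \<in> {v \<in> mor \<Lambda>. rng \<Lambda> v = v}"
  then show "v \<in> grade \<Lambda> 0" using deg_rng[of v] by (auto simp: grade_def)
qed

definition graph_iso :: "'a graph \<Rightarrow> 'b graph \<Rightarrow> ('a \<Rightarrow> 'b) \<Rightarrow> bool"
  where "graph_iso \<Lambda> \<Gamma> F \<longleftrightarrow>
    is_functor \<Lambda> \<Gamma> F \<and> bij_betw F (mor \<Lambda>) (mor \<Gamma>) \<and>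
    (\<forall>\<eta>\<in>mor \<Lambda>. deg \<Gamma> (F \<eta>) = deg \<Lambda> \<eta>)"

definition graph_sum :: "'a graph \<Rightarrow> 'b graph \<Rightarrow> ('a + 'b) graph"
  where "graph_sum \<Lambda> \<Gamma> =
    \<lparr>mor = mor \<Lambda> <+> mor \<Gamma>,
     rng = map_sum (rng \<Lambda>) (rng \<Gamma>),
     src = map_sum (src \<Lambda>) (src \<Gamma>),
     cmp = (\<lambda>x y. case (x, y) of
         (Inl \<mu>, Inl \<nu>) \<Rightarrow> Inl (cmp \<Lambda> \<mu> \<nu>)
       | (Inr \<mu>, Inr \<nu>) \<Rightarrow> Inr (cmp \<Gamma> \<mu> \<nu>)
       | _ \<Rightarrow> undefined),
     deg = case_sum (deg \<Lambda>) (deg \<Gamma>)\<rparr>"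

text \<open>\<open>\<Sigma>\<^sup>\<iota>\<close>; its degree map is that of \<open>\<Sigma>\<close> pulled back along the injection \<open>\<iota>\<close>.\<close>

definition iota_part :: "nat \<Rightarrow> 'c graph \<Rightarrow> 'c graph"
  where "iota_part k \<Sigma> =
    \<Sigma>\<lparr>mor := (\<Union>n\<in>Nat_pow k. grade \<Sigma> (iota k n)),
      deg := (\<lambda>\<sigma>. the_inv_into (Nat_pow k) (iota k) (deg \<Sigma> \<sigma>))\<rparr>"

definition quasimorphism :: "nat \<Rightarrow> 'a graph \<Rightarrow> 'c graph \<Rightarrow> ('a \<Rightarrow> 'c) \<Rightarrow> bool"
  where "quasimorphism k \<Lambda> \<Sigma> F \<longleftrightarrow>
    is_functor \<Lambda> \<Sigma> F \<and> (\<forall>\<eta>\<in>mor \<Lambda>. deg \<Sigma> (F \<eta>) = iota k (deg \<Lambda> \<eta>))"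

section \<open>Morphs\<close>

record ('x, 'a, 'b) morph =
  carrier :: "'x set"
  mrng :: "'x \<Rightarrow> 'a"
  msrc :: "'x \<Rightarrow> 'b"
  phi :: "'x \<times> 'b \<Rightarrow> 'a \<times> 'x"

definition right_fibre :: "'b graph \<Rightarrow> ('x, 'a, 'b) morph \<Rightarrow> ('x \<times> 'b) set"
  where "right_fibre \<Gamma> X = {(x, \<gamma>). x \<in> carrier X \<and> \<gamma> \<in> mor \<Gamma> \<and> msrc X x = rng \<Gamma> \<gamma>}"

definition left_fibre :: "'a graph \<Rightarrow> ('x, 'a, 'b) morph \<Rightarrow> ('a \<times> 'x) set"
  where "left_fibre \<Lambda> X = {(\<eta>, x). \<eta> \<in> mor \<Lambda> \<and> x \<in> carrier X \<and> src \<Lambda> \<eta> = mrng X x}"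

locale k_morph =
  fixes \<Lambda> :: "'a graph" and \<Gamma> :: "'b graph" and X :: "('x, 'a, 'b) morph"
  assumes countable_carrier: "countable (carrier X)"
    and mrng_vertex: "x \<in> carrier X \<Longrightarrow> mrng X x \<in> grade \<Lambda> 0"
    and msrc_vertex: "x \<in> carrier X \<Longrightarrow> msrc X x \<in> grade \<Gamma> 0"
    and bij_phi: "bij_betw (phi X) (right_fibre \<Gamma> X) (left_fibre \<Lambda> X)"
    and phi_deg: "\<lbrakk>(x\<^sub>1, \<gamma>\<^sub>1) \<in> right_fibre \<Gamma> X; phi X (x\<^sub>1, \<gamma>\<^sub>1) = (\<eta>\<^sub>1, x\<^sub>2)\<rbrakk>
      \<Longrightarrow> deg \<Gamma> \<gamma>\<^sub>1 = deg \<Lambda> \<eta>\<^sub>1"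
    and phi_src: "\<lbrakk>(x\<^sub>1, \<gamma>\<^sub>1) \<in> right_fibre \<Gamma> X; phi X (x\<^sub>1, \<gamma>\<^sub>1) = (\<eta>\<^sub>1, x\<^sub>2)\<rbrakk>
      \<Longrightarrow> src \<Gamma> \<gamma>\<^sub>1 = msrc X x\<^sub>2"
    and phi_rng: "\<lbrakk>(x\<^sub>1, \<gamma>\<^sub>1) \<in> right_fibre \<Gamma> X; phi X (x\<^sub>1, \<gamma>\<^sub>1) = (\<eta>\<^sub>1, x\<^sub>2)\<rbrakk>
      \<Longrightarrow> rng \<Lambda> \<eta>\<^sub>1 = mrng X x\<^sub>1"
    and phi_cmp: "\<lbrakk>(x\<^sub>1, \<gamma>\<^sub>1) \<in> right_fibre \<Gamma> X; phi X (x\<^sub>1, \<gamma>\<^sub>1) = (\<eta>\<^sub>1, x\<^sub>2);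
        (x\<^sub>2, \<gamma>\<^sub>2) \<in> right_fibre \<Gamma> X; phi X (x\<^sub>2, \<gamma>\<^sub>2) = (\<eta>\<^sub>2, x\<^sub>3)\<rbrakk>
      \<Longrightarrow> phi X (x\<^sub>1, cmp \<Gamma> \<gamma>\<^sub>1 \<gamma>\<^sub>2) = (cmp \<Lambda> \<eta>\<^sub>1 \<eta>\<^sub>2, x\<^sub>3)"

definition morph_iso ::
  "'b graph \<Rightarrow> ('x, 'a, 'b) morph \<Rightarrow> ('y, 'a, 'b) morph \<Rightarrow> ('x \<Rightarrow> 'y) \<Rightarrow> bool"
  where "morph_iso \<Gamma> X Y \<theta> \<longleftrightarrow>
    bij_betw \<theta> (carrier X) (carrier Y) \<and>
    (\<forall>x\<in>carrier X. mrng Y (\<theta> x) = mrng X x \<and> msrc Y (\<theta> x) = msrc X x) \<and>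
    (\<forall>p\<in>right_fibre \<Gamma> X. (map_prod id \<theta> \<circ> phi X) p = (phi Y \<circ> map_prod \<theta> id) p)"

section \<open>Linking graphs\<close>

text \<open>
  Under the conditions imposed on \<open>\<Sigma>\<close> and \<open>i\<close> in \<open>linking_graph\<close>, each description below has a unique
  solution; for \<open>phi\<close> this concerns arguments \<open>(\<alpha>, \<gamma>)\<close> in the fibre product only.
\<close>

definition morph_of :: "nat \<Rightarrow> 'a graph \<Rightarrow> 'b graph \<Rightarrow> 'c graph \<Rightarrow> ('a + 'b \<Rightarrow> 'c) \<Rightarrow> ('c, 'a, 'b) morph"
  where "morph_of k \<Lambda> \<Gamma> \<Sigma> i =
    \<lparr>carrier = grade \<Sigma> (gen k),
     mrng = (\<lambda>\<alpha>. THE v. v \<in> grade \<Lambda> 0 \<and> i (Inl v) = rng \<Sigma> \<alpha>),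
     msrc = (\<lambda>\<alpha>. THE w. w \<in> grade \<Gamma> 0 \<and> i (Inr w) = src \<Sigma> \<alpha>),
     phi = (\<lambda>(\<alpha>, \<gamma>). THE (\<eta>, \<alpha>'). \<eta> \<in> grade \<Lambda> (deg \<Gamma> \<gamma>) \<and> \<alpha>' \<in> grade \<Sigma> (gen k) \<and>
       src \<Sigma> (i (Inl \<eta>)) = rng \<Sigma> \<alpha>' \<and>
       cmp \<Sigma> \<alpha> (i (Inr \<gamma>)) = cmp \<Sigma> (i (Inl \<eta>)) \<alpha>')\<rparr>"

definition linking_graph ::
  "nat \<Rightarrow> 'a graph \<Rightarrow> 'b graph \<Rightarrow> ('x, 'a, 'b) morph \<Rightarrow> 'c graph \<Rightarrow> ('a + 'b \<Rightarrow> 'c) \<Rightarrow> bool"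
  where "linking_graph k \<Lambda> \<Gamma> X \<Sigma> i \<longleftrightarrow>
    k_graph (k + 1) \<Sigma> \<and>
    (quasimorphism k (graph_sum \<Lambda> \<Gamma>) \<Sigma> i \<and> graph_iso (graph_sum \<Lambda> \<Gamma>) (iota_part k \<Sigma>) i) \<and>
    (\<forall>\<alpha>\<in>grade \<Sigma> (gen k). src \<Sigma> \<alpha> \<in> i ` Inr ` grade \<Gamma> 0 \<and> rng \<Sigma> \<alpha> \<in> i ` Inl ` grade \<Lambda> 0) \<and>
    (\<exists>\<theta>. morph_iso \<Gamma> (morph_of k \<Lambda> \<Gamma> \<Sigma> i) X \<theta>)"

end

theory Submission imports Defs begin

text \<open>
  Every linking graph \<open>\<Sigma>\<close> consists of \<open>\<Lambda>\<close>, \<open>\<Gamma>\<close> and the paths of degree \<open>(n, 1)\<close>: two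
  edges of degree \<open>e\<^sub>k\<^sub>+\<^sub>1\<close> can never be composed, since one would have to start in \<open>\<Lambda>\<^sup>0\<close>. By the
  factorisation property each path of degree \<open>(n, 1)\<close> is \<open>\<eta>\<alpha>\<close> for a unique \<open>\<eta> \<in> \<Lambda>\<^sup>n\<close> and
  a unique \<open>\<alpha>\<close> of degree \<open>e\<^sub>k\<^sub>+\<^sub>1\<close>, that is, an element of \<open>X\<close>. Composition is then forced:
  \<open>(\<eta>x)\<gamma> = (\<eta>\<mu>)y\<close> where \<open>\<phi>(x, \<gamma>) = (\<mu>, y)\<close>. These formulas define a linking graph on the
  pairs \<open>(\<eta>, x)\<close>, to which every other linking graph is isomorphic.
\<close>

section \<open>Degrees and higher-rank graphs\<close>

lemma Nat_pow_SucD: "\<lbrakk>n \<in> Nat_pow (Suc k); n k = 0\<rbrakk> \<Longrightarrow> n \<in> Nat_pow k"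
  unfolding Nat_pow_def by (simp, metis le_antisym not_less_eq_eq)

lemma Nat_pow_SucI: "n \<in> Nat_pow k \<Longrightarrow> n \<in> Nat_pow (Suc k)"
  by (simp add: Nat_pow_def)

lemma Nat_pow_top: "n \<in> Nat_pow k \<Longrightarrow> n k = 0"
  by (simp add: Nat_pow_def)

lemma add_Nat_pow [simp]: "m + n \<in> Nat_pow k \<longleftrightarrow> m \<in> Nat_pow k \<and> n \<in> Nat_pow k"
  unfolding Nat_pow_def mem_Collect_eq plus_fun_apply by (metis add_is_0)

lemma gen_Nat_pow_Suc [simp]: "gen k \<in> Nat_pow (Suc k)"
  by (simp add: Nat_pow_def gen_def)

lemma gen_same [simp]: "gen k k = 1"
  by (simp add: gen_def)

text \<open>The last coordinate is positive, so the truncated subtraction of \<open>gen k\<close> is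
  exact. This is how an edge of the new direction is peeled off a path.\<close>

lemma Nat_pow_split_gen:
  assumes "n \<in> Nat_pow (Suc k)" "n k \<noteq> 0"
  obtains m where "m \<in> Nat_pow (Suc k)" "n = m + gen k"
proof
  let ?m = "\<lambda>l. n l - gen k l"
  show "?m \<in> Nat_pow (Suc k)" using assms by (simp add: Nat_pow_def)
  show "n = ?m + gen k" using assms by (auto simp: gen_def fun_eq_iff)
qed

text \<open>Since degrees are functions on \<open>nat\<close> with bounded support,
  \<open>\<iota>\<close> is a literal inclusion, and degrees in \<Lambda>, \<Gamma> and \<Sigma> can
  be compared without coercion.\<close>

lemma iota_id: "n \<in> Nat_pow k \<Longrightarrow> iota k n = n"
  by (auto simp: iota_def Nat_pow_def fun_eq_iff not_less)

section \<open>Existence and cancellation of factorisations\<close>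

context k_graph
begin

lemma factorisation_exists:
  assumes "\<eta> \<in> mor \<Lambda>" "deg \<Lambda> \<eta> = m + n"
  obtains \<mu> \<nu> where "\<mu> \<in> mor \<Lambda>" "\<nu> \<in> mor \<Lambda>" "deg \<Lambda> \<mu> = m" "deg \<Lambda> \<nu> = n"
    "src \<Lambda> \<mu> = rng \<Lambda> \<nu>" "\<eta> = cmp \<Lambda> \<mu> \<nu>"
proof -
  have "m \<in> Nat_pow k" "n \<in> Nat_pow k" using deg_Nat_pow[OF assms(1)] assms(2) by auto
  from factorisation[OF assms(1) this assms(2)] show ?thesis
    using that by (auto simp: grade_def)
qed

lemma factorisation_unique:
  assumes "\<mu> \<in> mor \<Lambda>" "\<nu> \<in> mor \<Lambda>" "src \<Lambda> \<mu> = rng \<Lambda> \<nu>"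
    and "\<mu>' \<in> mor \<Lambda>" "\<nu>' \<in> mor \<Lambda>" "src \<Lambda> \<mu>' = rng \<Lambda> \<nu>'"
    and "deg \<Lambda> \<mu> = deg \<Lambda> \<mu>'" "deg \<Lambda> \<nu> = deg \<Lambda> \<nu>'"
    and "cmp \<Lambda> \<mu> \<nu> = cmp \<Lambda> \<mu>' \<nu>'"
  shows "\<mu> = \<mu>'" "\<nu> = \<nu>'"
proof -
  let ?P = "\<lambda>p. case p of (\<mu>', \<nu>') \<Rightarrow> \<mu>' \<in> grade \<Lambda> (deg \<Lambda> \<mu>) \<and>
    \<nu>' \<in> grade \<Lambda> (deg \<Lambda> \<nu>) \<and> src \<Lambda> \<mu>' = rng \<Lambda> \<nu>' \<and> cmp \<Lambda> \<mu> \<nu> = cmp \<Lambda> \<mu>' \<nu>'"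
  have "cmp \<Lambda> \<mu> \<nu> \<in> mor \<Lambda>" "deg \<Lambda> (cmp \<Lambda> \<mu> \<nu>) = deg \<Lambda> \<mu> + deg \<Lambda> \<nu>"
    using assms by (simp_all add: cmp_mor deg_cmp)
  from factorisation[OF this(1) deg_Nat_pow deg_Nat_pow this(2), OF assms(1,2)]
  have "\<exists>!p. ?P p" .
  moreover have "?P (\<mu>, \<nu>)" "?P (\<mu>', \<nu>')" using assms by (auto simp: grade_def)
  ultimately have "(\<mu>, \<nu>) = (\<mu>', \<nu>')" by blast
  then show "\<mu> = \<mu>'" "\<nu> = \<nu>'" by auto
qed

lemma vertexD:
  assumes "v \<in> grade \<Lambda> 0"
  shows "v \<in> mor \<Lambda>" "rng \<Lambda> v = v" "src \<Lambda> v = v" "deg \<Lambda> v = 0"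
proof -
  show v: "v \<in> mor \<Lambda>" "deg \<Lambda> v = 0" using assms by (auto simp: grade_def)
  show r: "rng \<Lambda> v = v" using assms grade_0_eq by auto
  show "src \<Lambda> v = v" using src_rng[OF v(1)] r by simp
qed

end

text \<open>Splits the factorisation property into existence and cancellation, because the two rest
  on different facts about \<open>\<phi>\<close> for the canonical model: surjectivity and
  injectivity.\<close>

lemma k_graphI:
  assumes "small_category \<Lambda>" "mor \<Lambda> \<noteq> {}" "countable (mor \<Lambda>)"
    and "\<And>\<eta>. \<eta> \<in> mor \<Lambda> \<Longrightarrow> deg \<Lambda> \<eta> \<in> Nat_pow k"
    and "\<And>\<eta>. \<eta> \<in> mor \<Lambda> \<Longrightarrow> deg \<Lambda> (rng \<Lambda> \<eta>) = 0"
    and "\<And>\<eta>. \<eta> \<in> mor \<Lambda> \<Longrightarrow> deg \<Lambda> (src \<Lambda> \<eta>) = 0"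
    and "\<And>\<mu> \<nu>. \<lbrakk>\<mu> \<in> mor \<Lambda>; \<nu> \<in> mor \<Lambda>; src \<Lambda> \<mu> = rng \<Lambda> \<nu>\<rbrakk>
      \<Longrightarrow> deg \<Lambda> (cmp \<Lambda> \<mu> \<nu>) = deg \<Lambda> \<mu> + deg \<Lambda> \<nu>"
    and ex: "\<And>\<eta> m n. \<lbrakk>\<eta> \<in> mor \<Lambda>; deg \<Lambda> \<eta> = m + n\<rbrakk>
      \<Longrightarrow> \<exists>\<mu>\<in>mor \<Lambda>. \<exists>\<nu>\<in>mor \<Lambda>. deg \<Lambda> \<mu> = m \<and> deg \<Lambda> \<nu> = n \<and> src \<Lambda> \<mu> = rng \<Lambda> \<nu> \<and> \<eta> = cmp \<Lambda> \<mu> \<nu>"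
    and un: "\<And>\<mu> \<nu> \<mu>' \<nu>'. \<lbrakk>\<mu> \<in> mor \<Lambda>; \<nu> \<in> mor \<Lambda>; src \<Lambda> \<mu> = rng \<Lambda> \<nu>;
      \<mu>' \<in> mor \<Lambda>; \<nu>' \<in> mor \<Lambda>; src \<Lambda> \<mu>' = rng \<Lambda> \<nu>';
      deg \<Lambda> \<mu> = deg \<Lambda> \<mu>'; deg \<Lambda> \<nu> = deg \<Lambda> \<nu>'; cmp \<Lambda> \<mu> \<nu> = cmp \<Lambda> \<mu>' \<nu>'\<rbrakk>
      \<Longrightarrow> \<mu> = \<mu>' \<and> \<nu> = \<nu>'"
  shows "k_graph k \<Lambda>"
proof -
  interpret small_category \<Lambda> by fact
  show ?thesis
  proof (unfold_locales, fact+, goal_cases)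
    case (1 \<eta> m n)
    then obtain \<mu> \<nu> where f: "\<mu> \<in> mor \<Lambda>" "\<nu> \<in> mor \<Lambda>" "deg \<Lambda> \<mu> = m" "deg \<Lambda> \<nu> = n"
      "src \<Lambda> \<mu> = rng \<Lambda> \<nu>" "\<eta> = cmp \<Lambda> \<mu> \<nu>" using ex by blast
    show ?case
    proof (rule ex1I[of _ "(\<mu>, \<nu>)"])
      show "case (\<mu>, \<nu>) of (\<mu>, \<nu>) \<Rightarrow> \<mu> \<in> grade \<Lambda> m \<and> \<nu> \<in> grade \<Lambda> n \<and>
        src \<Lambda> \<mu> = rng \<Lambda> \<nu> \<and> \<eta> = cmp \<Lambda> \<mu> \<nu>" using f by (simp add: grade_def)
    next
      fix p assume "case p of (\<mu>, \<nu>) \<Rightarrow> \<mu> \<in> grade \<Lambda> m \<and> \<nu> \<in> grade \<Lambda> n \<and>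
        src \<Lambda> \<mu> = rng \<Lambda> \<nu> \<and> \<eta> = cmp \<Lambda> \<mu> \<nu>"
      then show "p = (\<mu>, \<nu>)" using f un by (cases p) (auto simp: grade_def)
    qed
  qed
qed

section \<open>Functors, isomorphisms and transport of structure\<close>

lemma is_functor_comp:
  assumes F: "is_functor C D F" and G: "is_functor D E G"
  shows "is_functor C E (G \<circ> F)"
proof -
  have "src D (F f) = rng D (F g)" if "f \<in> mor C" "g \<in> mor C" "src C f = rng C g" for f g
    using F that by (metis is_functor_def)
  then show ?thesis using F G by (simp add: is_functor_def)
qed

lemma graph_isoD:
  assumes "graph_iso \<Lambda> \<Gamma> F"
  shows "bij_betw F (mor \<Lambda>) (mor \<Gamma>)"
    and "f \<in> mor \<Lambda> \<Longrightarrow> F f \<in> mor \<Gamma>"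
    and "f \<in> mor \<Lambda> \<Longrightarrow> rng \<Gamma> (F f) = F (rng \<Lambda> f)"
    and "f \<in> mor \<Lambda> \<Longrightarrow> src \<Gamma> (F f) = F (src \<Lambda> f)"
    and "f \<in> mor \<Lambda> \<Longrightarrow> deg \<Gamma> (F f) = deg \<Lambda> f"
    and "\<lbrakk>f \<in> mor \<Lambda>; g \<in> mor \<Lambda>; src \<Lambda> f = rng \<Lambda> g\<rbrakk>
      \<Longrightarrow> F (cmp \<Lambda> f g) = cmp \<Gamma> (F f) (F g)"
  using assms by (auto simp: graph_iso_def is_functor_def)

lemma graph_iso_comp:
  assumes "graph_iso \<Lambda> \<Gamma> F" "graph_iso \<Gamma> \<Delta> G"
  shows "graph_iso \<Lambda> \<Delta> (G \<circ> F)"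
  using assms bij_betw_trans[of F "mor \<Lambda>" "mor \<Gamma>" G] is_functor_comp[of \<Lambda> \<Gamma> F \<Delta> G]
    graph_isoD(2)[OF assms(1)]
  by (simp add: graph_iso_def)

text \<open>The inverse cancels \<open>F\<close> only on \<open>mor \<Lambda>\<close>; the category
  axioms for \<Lambda> ensure that ranges, sources and composites of preimages lie there.\<close>

lemma graph_iso_inv:
  assumes "small_category \<Lambda>" and iso: "graph_iso \<Lambda> \<Gamma> F"
  shows "graph_iso \<Gamma> \<Lambda> (inv_into (mor \<Lambda>) F)"
proof -
  interpret small_category \<Lambda> by fact
  let ?G = "inv_into (mor \<Lambda>) F"
  note F = graph_isoD[OF iso]
  have inj: "inj_on F (mor \<Lambda>)" using F(1) by (rule bij_betw_imp_inj_on)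
  have G: "bij_betw ?G (mor \<Gamma>) (mor \<Lambda>)" by (rule bij_betw_inv_into[OF F(1)])
  have Gm: "?G f \<in> mor \<Lambda>" and FG: "F (?G f) = f" if "f \<in> mor \<Gamma>" for f
    using that G F(1) by (auto simp: bij_betw_apply bij_betw_inv_into_right)
  have GF: "?G (F f) = f" if "f \<in> mor \<Lambda>" for f using inj that by simp
  have r: "?G (rng \<Gamma> f) = rng \<Lambda> (?G f)" if "f \<in> mor \<Gamma>" for f
    using GF[OF rng_mor[OF Gm[OF that]]] F(3)[OF Gm[OF that]] FG[OF that] by simp
  have s: "?G (src \<Gamma> f) = src \<Lambda> (?G f)" if "f \<in> mor \<Gamma>" for f
    using GF[OF src_mor[OF Gm[OF that]]] F(4)[OF Gm[OF that]] FG[OF that] by simp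
  have "?G (cmp \<Gamma> f g) = cmp \<Lambda> (?G f) (?G g)"
    if fg: "f \<in> mor \<Gamma>" "g \<in> mor \<Gamma>" "src \<Gamma> f = rng \<Gamma> g" for f g
  proof -
    have c: "src \<Lambda> (?G f) = rng \<Lambda> (?G g)" using fg r s by metis
    show ?thesis
      using GF[OF cmp_mor[OF Gm Gm c]] F(6)[OF Gm Gm c] fg FG by simp
  qed
  moreover have "deg \<Lambda> (?G f) = deg \<Gamma> f" if "f \<in> mor \<Gamma>" for f
    using F(5)[OF Gm[OF that]] FG[OF that] by simp
  ultimately show ?thesis
    using G Gm r s by (simp add: graph_iso_def is_functor_def)
qed

text \<open>Transport of structure along an injection. The canonical model lives on a type built
  from those of \<Lambda>, \<Gamma> and X, while existence is claimed over
  \<open>nat\<close>.\<close>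

definition relabel :: "('a \<Rightarrow> 'c) \<Rightarrow> 'a graph \<Rightarrow> 'c graph"
  where "relabel f \<Lambda> = (let g = inv_into (mor \<Lambda>) f in
    \<lparr>mor = f ` mor \<Lambda>, rng = (\<lambda>x. f (rng \<Lambda> (g x))), src = (\<lambda>x. f (src \<Lambda> (g x))),
     cmp = (\<lambda>x y. f (cmp \<Lambda> (g x) (g y))), deg = (\<lambda>x. deg \<Lambda> (g x))\<rparr>)"

lemma relabel:
  assumes "k_graph k \<Lambda>" "inj_on f (mor \<Lambda>)"
  shows "k_graph k (relabel f \<Lambda>)" and "graph_iso \<Lambda> (relabel f \<Lambda>) f"
proof -
  interpret k_graph k \<Lambda> by fact
  have inv: "inv_into (mor \<Lambda>) f (f x) = x" if "x \<in> mor \<Lambda>" for x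
    using assms(2) that by simp
  have eq: "f x = f y \<longleftrightarrow> x = y" if "x \<in> mor \<Lambda>" "y \<in> mor \<Lambda>" for x y
    using assms(2) that by (auto simp: inj_on_eq_iff)
  have sel: "mor (relabel f \<Lambda>) = f ` mor \<Lambda>"
    "x \<in> mor \<Lambda> \<Longrightarrow> rng (relabel f \<Lambda>) (f x) = f (rng \<Lambda> x)"
    "x \<in> mor \<Lambda> \<Longrightarrow> src (relabel f \<Lambda>) (f x) = f (src \<Lambda> x)"
    "x \<in> mor \<Lambda> \<Longrightarrow> deg (relabel f \<Lambda>) (f x) = deg \<Lambda> x"
    "\<lbrakk>x \<in> mor \<Lambda>; y \<in> mor \<Lambda>\<rbrakk> \<Longrightarrow> cmp (relabel f \<Lambda>) (f x) (f y) = f (cmp \<Lambda> x y)"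
    for x y by (simp_all add: relabel_def Let_def inv)
  have cat: "small_category (relabel f \<Lambda>)"
    by unfold_locales
      (auto simp: sel eq rng_mor src_mor cmp_mor rng_rng src_rng rng_src src_src rng_cmp src_cmp
        cmp_rng cmp_src cmp_assoc)
  show "k_graph k (relabel f \<Lambda>)"
  proof (rule k_graphI[OF cat], goal_cases)
    case (7 \<eta> m n)
    then obtain \<zeta> where z: "\<eta> = f \<zeta>" "\<zeta> \<in> mor \<Lambda>" "deg \<Lambda> \<zeta> = m + n" by (auto simp: sel)
    from factorisation_exists[OF z(2,3)] obtain \<mu> \<nu> where
      "\<mu> \<in> mor \<Lambda>" "\<nu> \<in> mor \<Lambda>" "deg \<Lambda> \<mu> = m" "deg \<Lambda> \<nu> = n" "src \<Lambda> \<mu> = rng \<Lambda> \<nu>" "\<zeta> = cmp \<Lambda> \<mu> \<nu>" .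
    then show ?case unfolding sel by (intro bexI[of _ "f \<mu>"] bexI[of _ "f \<nu>"]) (auto simp: sel z)
  next
    case (8 \<mu> \<nu> \<mu>' \<nu>')
    then obtain a b c d where
      "\<mu> = f a" "\<nu> = f b" "\<mu>' = f c" "\<nu>' = f d" "a \<in> mor \<Lambda>" "b \<in> mor \<Lambda>" "c \<in> mor \<Lambda>" "d \<in> mor \<Lambda>"
      by (auto simp: sel)
    with 8 show ?case
      using factorisation_unique[of a b c d] by (simp add: sel eq rng_mor src_mor cmp_mor)
  qed (use nonempty countable_mor in
      \<open>auto simp: sel eq rng_mor src_mor cmp_mor deg_Nat_pow deg_rng deg_src deg_cmp\<close>)
  show "graph_iso \<Lambda> (relabel f \<Lambda>) f"
    using assms(2) by (simp add: graph_iso_def is_functor_def sel bij_betw_def)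
qed

section \<open>The canonical linking graph\<close>

locale graph_morph = L: k_graph k \<Lambda> + G: k_graph k \<Gamma> + k_morph \<Lambda> \<Gamma> X
  for k :: nat and \<Lambda> :: "'a graph" and \<Gamma> :: "'b graph" and X :: "('x, 'a, 'b) morph"
begin

section \<open>Elementary consequences of the morph axioms\<close>

lemma mrng_simps [simp]:
  assumes "x \<in> carrier X"
  shows "mrng X x \<in> mor \<Lambda>" "rng \<Lambda> (mrng X x) = mrng X x" "src \<Lambda> (mrng X x) = mrng X x"
    "deg \<Lambda> (mrng X x) = 0"
  using L.vertexD[OF mrng_vertex[OF assms]] by auto

lemma msrc_simps [simp]:
  assumes "x \<in> carrier X"
  shows "msrc X x \<in> mor \<Gamma>" "rng \<Gamma> (msrc X x) = msrc X x" "src \<Gamma> (msrc X x) = msrc X x"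
    "deg \<Gamma> (msrc X x) = 0"
  using G.vertexD[OF msrc_vertex[OF assms]] by auto

lemma phiD:
  assumes "x \<in> carrier X" "\<gamma> \<in> mor \<Gamma>" "msrc X x = rng \<Gamma> \<gamma>" "phi X (x, \<gamma>) = (\<eta>, y)"
  shows "\<eta> \<in> mor \<Lambda>" "y \<in> carrier X" "src \<Lambda> \<eta> = mrng X y" "rng \<Lambda> \<eta> = mrng X x"
    "msrc X y = src \<Gamma> \<gamma>" "deg \<Lambda> \<eta> = deg \<Gamma> \<gamma>"
proof -
  have f: "(x, \<gamma>) \<in> right_fibre \<Gamma> X" using assms by (simp add: right_fibre_def)
  have "(\<eta>, y) \<in> left_fibre \<Lambda> X" using bij_betw_apply[OF bij_phi f] assms(4) by simp
  then show "\<eta> \<in> mor \<Lambda>" "y \<in> carrier X" "src \<Lambda> \<eta> = mrng X y" by (auto simp: left_fibre_def)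
  show "rng \<Lambda> \<eta> = mrng X x" "msrc X y = src \<Gamma> \<gamma>" "deg \<Lambda> \<eta> = deg \<Gamma> \<gamma>"
    using phi_rng[OF f assms(4)] phi_src[OF f assms(4)] phi_deg[OF f assms(4)] by simp_all
qed

lemma phi_inj:
  assumes "x \<in> carrier X" "\<gamma> \<in> mor \<Gamma>" "msrc X x = rng \<Gamma> \<gamma>"
    and "x' \<in> carrier X" "\<gamma>' \<in> mor \<Gamma>" "msrc X x' = rng \<Gamma> \<gamma>'"
    and "phi X (x, \<gamma>) = phi X (x', \<gamma>')"
  shows "x = x'" "\<gamma> = \<gamma>'"
  using bij_betw_imp_inj_on[OF bij_phi] assms by (auto simp: right_fibre_def dest: inj_onD)

text \<open>Lets a \<Lambda>-path in front of an element of X be moved behind it as a \<Gamma>-path,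
  against the direction of the normal form.\<close>

lemma phi_surj:
  assumes "\<eta> \<in> mor \<Lambda>" "y \<in> carrier X" "src \<Lambda> \<eta> = mrng X y"
  obtains x \<gamma> where "x \<in> carrier X" "\<gamma> \<in> mor \<Gamma>" "msrc X x = rng \<Gamma> \<gamma>" "phi X (x, \<gamma>) = (\<eta>, y)"
proof -
  have "(\<eta>, y) \<in> phi X ` right_fibre \<Gamma> X"
    using assms bij_betw_imp_surj_on[OF bij_phi] by (simp add: left_fibre_def)
  then obtain p where "p \<in> right_fibre \<Gamma> X" "phi X p = (\<eta>, y)" by (metis imageE)
  then show ?thesis using that by (cases p) (auto simp: right_fibre_def)
qed

lemma phi_cmp':
  assumes "x \<in> carrier X" "\<gamma> \<in> mor \<Gamma>" "msrc X x = rng \<Gamma> \<gamma>" "phi X (x, \<gamma>) = (\<eta>, y)"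
    and "\<gamma>' \<in> mor \<Gamma>" "src \<Gamma> \<gamma> = rng \<Gamma> \<gamma>'" "phi X (y, \<gamma>') = (\<eta>', z)"
  shows "phi X (x, cmp \<Gamma> \<gamma> \<gamma>') = (cmp \<Lambda> \<eta> \<eta>', z)"
  using phi_cmp[of x \<gamma> \<eta> y \<gamma>' \<eta>' z] assms phiD[OF assms(1-4)] by (simp add: right_fibre_def)

text \<open>By \<open>phi_cmp\<close>, \<open>\<phi>\<close> acts idempotently on the pairs \<open>(x, s(x))\<close>; being injective, it fixes them.\<close>

lemma phi_msrc:
  assumes x: "x \<in> carrier X"
  shows "phi X (x, msrc X x) = (mrng X x, x)"
proof -
  obtain \<eta> y where 1: "phi X (x, msrc X x) = (\<eta>, y)" by fastforce
  have s: "msrc X x = rng \<Gamma> (msrc X x)" using x by simp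
  note P = phiD[OF x msrc_simps(1)[OF x] s 1]
  obtain \<zeta> z where 2: "phi X (y, msrc X x) = (\<zeta>, z)" by fastforce
  have sy: "msrc X y = msrc X x" using P x by simp
  note Q = phiD[OF P(2) msrc_simps(1)[OF x], unfolded sy, OF s 2]
  \<comment> \<open>The identity s(x) composed with itself is s(x), so this evaluates
    \<open>phi X (x, msrc X x)\<close> a second time; comparing second components gives z =
    y.\<close>
  have "phi X (x, cmp \<Gamma> (msrc X x) (msrc X x)) = (cmp \<Lambda> \<eta> \<zeta>, z)"
    using phi_cmp'[OF x msrc_simps(1)[OF x] s 1 msrc_simps(1)[OF x] _ 2] x by simp
  then have "z = y" using 1 G.cmp_src[OF msrc_simps(1)[OF x]] x by simp
  \<comment> \<open>Having degree 0, both are identities: \<eta> equals its range r(x), and \<zeta>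
    equals its range r(y), which is the source of \<eta>. Hence (x, s(x)) and (y, s(x)) have the
    same image.\<close>
  have "\<eta> \<in> grade \<Lambda> 0" "\<zeta> \<in> grade \<Lambda> 0" using P Q x by (auto simp: grade_def)
  note v = L.vertexD[OF this(1)] L.vertexD[OF this(2)]
  have "\<eta> = mrng X x" using P v by simp
  moreover have "\<zeta> = \<eta>" using Q P v \<open>z = y\<close> by simp
  ultimately show ?thesis
    using phi_inj(1)[OF x msrc_simps(1)[OF x] s P(2) msrc_simps(1)[OF x]] sy s 1 2 \<open>z = y\<close> by simp
qed

end

text \<open>\<open>Bridge \<eta> x\<close> stands for the composite \<open>\<eta>x\<close>, the normal form of a path crossing from
  \<open>\<Gamma>\<close> to \<open>\<Lambda>\<close>.\<close>

datatype ('a, 'b, 'x) link = Lft 'a | Rgt 'b | Bridge 'a 'x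

text \<open>In every pair left to the \<open>undefined\<close> clause the source of the first path
  and the range of the second lie on different sides, so no such pair is composable; two bridges are
  among them.\<close>

fun link_cmp where
  "link_cmp \<Lambda> \<Gamma> X (Lft \<mu>) (Lft \<nu>) = Lft (cmp \<Lambda> \<mu> \<nu>)"
| "link_cmp \<Lambda> \<Gamma> X (Rgt \<mu>) (Rgt \<nu>) = Rgt (cmp \<Gamma> \<mu> \<nu>)"
| "link_cmp \<Lambda> \<Gamma> X (Lft \<mu>) (Bridge \<eta> x) = Bridge (cmp \<Lambda> \<mu> \<eta>) x"
| "link_cmp \<Lambda> \<Gamma> X (Bridge \<eta> x) (Rgt \<gamma>) =
    (case phi X (x, \<gamma>) of (\<mu>, y) \<Rightarrow> Bridge (cmp \<Lambda> \<eta> \<mu>) y)"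
| "link_cmp \<Lambda> \<Gamma> X _ _ = undefined"

definition link_graph ::
  "nat \<Rightarrow> 'a graph \<Rightarrow> 'b graph \<Rightarrow> ('x, 'a, 'b) morph \<Rightarrow> ('a, 'b, 'x) link graph"
  where "link_graph k \<Lambda> \<Gamma> X =
    \<lparr>mor = Lft ` mor \<Lambda> \<union> Rgt ` mor \<Gamma> \<union> case_prod Bridge ` left_fibre \<Lambda> X,
     rng = case_link (\<lambda>\<eta>. Lft (rng \<Lambda> \<eta>)) (\<lambda>\<gamma>. Rgt (rng \<Gamma> \<gamma>)) (\<lambda>\<eta> x. Lft (rng \<Lambda> \<eta>)),
     src = case_link (\<lambda>\<eta>. Lft (src \<Lambda> \<eta>)) (\<lambda>\<gamma>. Rgt (src \<Gamma> \<gamma>)) (\<lambda>\<eta> x. Rgt (msrc X x)),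
     cmp = link_cmp \<Lambda> \<Gamma> X,
     deg = case_link (deg \<Lambda>) (deg \<Gamma>) (\<lambda>\<eta> x. deg \<Lambda> \<eta> + gen k)\<rparr>"

context graph_morph
begin

section \<open>Category structure of the canonical model\<close>

lemma mor_link [simp]:
  "Lft \<eta> \<in> mor (link_graph k \<Lambda> \<Gamma> X) \<longleftrightarrow> \<eta> \<in> mor \<Lambda>"
  "Rgt \<gamma> \<in> mor (link_graph k \<Lambda> \<Gamma> X) \<longleftrightarrow> \<gamma> \<in> mor \<Gamma>"
  "Bridge \<eta> x \<in> mor (link_graph k \<Lambda> \<Gamma> X) \<longleftrightarrow>
    \<eta> \<in> mor \<Lambda> \<and> x \<in> carrier X \<and> src \<Lambda> \<eta> = mrng X x"
  by (auto simp: link_graph_def left_fibre_def)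

lemma link_graph_sel [simp]:
  "rng (link_graph k \<Lambda> \<Gamma> X) =
    case_link (\<lambda>\<eta>. Lft (rng \<Lambda> \<eta>)) (\<lambda>\<gamma>. Rgt (rng \<Gamma> \<gamma>)) (\<lambda>\<eta> x. Lft (rng \<Lambda> \<eta>))"
  "src (link_graph k \<Lambda> \<Gamma> X) =
    case_link (\<lambda>\<eta>. Lft (src \<Lambda> \<eta>)) (\<lambda>\<gamma>. Rgt (src \<Gamma> \<gamma>)) (\<lambda>\<eta> x. Rgt (msrc X x))"
  "cmp (link_graph k \<Lambda> \<Gamma> X) = link_cmp \<Lambda> \<Gamma> X"
  "deg (link_graph k \<Lambda> \<Gamma> X) = case_link (deg \<Lambda>) (deg \<Gamma>) (\<lambda>\<eta> x. deg \<Lambda> \<eta> + gen k)"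
  by (simp_all add: link_graph_def)

lemma mor_linkE:
  assumes "f \<in> mor (link_graph k \<Lambda> \<Gamma> X)"
  obtains (Lft) \<eta> where "f = Lft \<eta>" "\<eta> \<in> mor \<Lambda>"
  | (Rgt) \<gamma> where "f = Rgt \<gamma>" "\<gamma> \<in> mor \<Gamma>"
  | (Bridge) \<eta> x where "f = Bridge \<eta> x" "\<eta> \<in> mor \<Lambda>" "x \<in> carrier X" "src \<Lambda> \<eta> = mrng X x"
  using assms by (cases f) auto

text \<open>Only four of the nine pairs of constructors are composable. The last case also records
  what \<open>phiD\<close> says about the image under \<open>\<phi>\<close>, so that later case
  analyses have it at hand.\<close>

lemma composable_linkE:
  assumes "f \<in> mor (link_graph k \<Lambda> \<Gamma> X)" "g \<in> mor (link_graph k \<Lambda> \<Gamma> X)"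
    and "src (link_graph k \<Lambda> \<Gamma> X) f = rng (link_graph k \<Lambda> \<Gamma> X) g"
  obtains (Lft_Lft) \<mu> \<nu> where "f = Lft \<mu>" "g = Lft \<nu>" "\<mu> \<in> mor \<Lambda>" "\<nu> \<in> mor \<Lambda>" "src \<Lambda> \<mu> = rng \<Lambda> \<nu>"
      "link_cmp \<Lambda> \<Gamma> X f g = Lft (cmp \<Lambda> \<mu> \<nu>)"
  | (Rgt_Rgt) \<mu> \<nu> where "f = Rgt \<mu>" "g = Rgt \<nu>" "\<mu> \<in> mor \<Gamma>" "\<nu> \<in> mor \<Gamma>" "src \<Gamma> \<mu> = rng \<Gamma> \<nu>"
      "link_cmp \<Lambda> \<Gamma> X f g = Rgt (cmp \<Gamma> \<mu> \<nu>)"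
  | (Lft_Bridge) \<mu> \<eta> x where "f = Lft \<mu>" "g = Bridge \<eta> x" "\<mu> \<in> mor \<Lambda>" "\<eta> \<in> mor \<Lambda>"
      "src \<Lambda> \<mu> = rng \<Lambda> \<eta>" "x \<in> carrier X" "src \<Lambda> \<eta> = mrng X x"
      "link_cmp \<Lambda> \<Gamma> X f g = Bridge (cmp \<Lambda> \<mu> \<eta>) x"
  | (Bridge_Rgt) \<eta> x \<gamma> \<mu> y where "f = Bridge \<eta> x" "g = Rgt \<gamma>" "\<eta> \<in> mor \<Lambda>" "x \<in> carrier X"
      "src \<Lambda> \<eta> = mrng X x" "\<gamma> \<in> mor \<Gamma>" "msrc X x = rng \<Gamma> \<gamma>" "phi X (x, \<gamma>) = (\<mu>, y)"
      "\<mu> \<in> mor \<Lambda>" "y \<in> carrier X" "src \<Lambda> \<mu> = mrng X y" "rng \<Lambda> \<mu> = mrng X x"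
      "msrc X y = src \<Gamma> \<gamma>" "deg \<Lambda> \<mu> = deg \<Gamma> \<gamma>"
      "link_cmp \<Lambda> \<Gamma> X f g = Bridge (cmp \<Lambda> \<eta> \<mu>) y"
  using assms(1)
proof (cases rule: mor_linkE)
  case (Lft \<eta>)
  with assms(2,3) show ?thesis using that(1,3) by (cases g) auto
next
  case (Rgt \<gamma>)
  with assms(2,3) show ?thesis using that(2) by (cases g) auto
next
  case (Bridge \<eta> x)
  with assms(2,3) obtain \<gamma> where g: "g = Rgt \<gamma>" "\<gamma> \<in> mor \<Gamma>" "msrc X x = rng \<Gamma> \<gamma>"
    by (cases g) auto
  obtain \<mu> y where p: "phi X (x, \<gamma>) = (\<mu>, y)" by fastforce
  show ?thesis
    using that(4)[of \<eta> x \<gamma> \<mu> y] Bridge g p phiD[OF Bridge(3) g(2,3) p] by simp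
qed

text \<open>Two axioms use the morph in an essential way: the right unit law for a bridge is
  \<open>phi_msrc\<close>, and associativity for a bridge followed by two \<Gamma>-paths is
  compatibility of \<open>\<phi>\<close> with composition. The rest is inherited from \<Lambda> and
  \<Gamma>.\<close>

lemma small_category_link: "small_category (link_graph k \<Lambda> \<Gamma> X)"
proof (unfold_locales, goal_cases)
  case (7 f g)
  then show ?case by (cases rule: composable_linkE) (auto simp: L.cmp_mor G.cmp_mor L.src_cmp)
next
  case (8 f g)
  then show ?case by (cases rule: composable_linkE) (auto simp: L.rng_cmp G.rng_cmp)
next
  case (9 f g)
  then show ?case by (cases rule: composable_linkE) (auto simp: L.src_cmp G.src_cmp)
next
  case (10 f)
  then show ?case by (cases rule: mor_linkE) (auto simp: L.cmp_rng G.cmp_rng)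
next
  case (11 f)
  then show ?case
  proof (cases rule: mor_linkE)
    case (Bridge \<eta> x)
    then show ?thesis using L.cmp_src[of \<eta>] by (simp add: phi_msrc)
  qed (auto simp: L.cmp_src G.cmp_src)
next
  case (12 f g h)
  note fg = 12(1,2,4) and gh = 12(2,3,5)
  from fg show ?case
  proof (cases rule: composable_linkE)
    case (Lft_Lft \<mu> \<nu>)
    from gh show ?thesis
      by (cases rule: composable_linkE) (use Lft_Lft in \<open>auto simp: L.cmp_assoc\<close>)
  next
    case (Rgt_Rgt \<mu> \<nu>)
    from gh show ?thesis
      by (cases rule: composable_linkE) (use Rgt_Rgt in \<open>auto simp: G.cmp_assoc\<close>)
  next
    case (Lft_Bridge \<mu> \<eta> x)
    from gh show ?thesis
      by (cases rule: composable_linkE) (use Lft_Bridge in \<open>auto simp: L.cmp_assoc\<close>)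
  next
    case fst: (Bridge_Rgt \<eta> x \<gamma> \<mu> y)
    from gh fst obtain \<gamma>' where h: "h = Rgt \<gamma>'" "\<gamma>' \<in> mor \<Gamma>" "src \<Gamma> \<gamma> = rng \<Gamma> \<gamma>'"
      by (cases rule: composable_linkE) auto
    obtain \<mu>' z where p: "phi X (y, \<gamma>') = (\<mu>', z)" by fastforce
    have "phi X (x, cmp \<Gamma> \<gamma> \<gamma>') = (cmp \<Lambda> \<mu> \<mu>', z)"
      using phi_cmp'[OF fst(4,6,7,8) h(2,3) p] .
    moreover have "cmp \<Lambda> (cmp \<Lambda> \<eta> \<mu>) \<mu>' = cmp \<Lambda> \<eta> (cmp \<Lambda> \<mu> \<mu>')"
      using L.cmp_assoc fst phiD[OF fst(10) h(2) _ p] h by simp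
    ultimately show ?thesis using fst h p by simp
  qed
qed (auto elim!: mor_linkE simp: L.rng_mor L.src_mor G.rng_mor G.src_mor L.rng_rng L.src_rng
    L.rng_src L.src_src G.rng_rng G.src_rng G.rng_src G.src_src)

section \<open>Degrees and unique factorisation in the canonical model\<close>

lemma deg_link_Nat_pow: "f \<in> mor (link_graph k \<Lambda> \<Gamma> X) \<Longrightarrow>
    deg (link_graph k \<Lambda> \<Gamma> X) f \<in> Nat_pow (Suc k)"
  by (auto elim!: mor_linkE simp: Nat_pow_SucI L.deg_Nat_pow G.deg_Nat_pow)

text \<open>The last coordinate of the degree detects bridges, so two paths of equal degree are
  either both bridges or both not.\<close>

lemma deg_link_top:
  assumes "f \<in> mor (link_graph k \<Lambda> \<Gamma> X)"
  shows "deg (link_graph k \<Lambda> \<Gamma> X) f k = (case f of Bridge _ _ \<Rightarrow> 1 | _ \<Rightarrow> 0)"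
  using assms
  by (cases rule: mor_linkE) (auto simp: Nat_pow_top[OF L.deg_Nat_pow] Nat_pow_top[OF G.deg_Nat_pow])

text \<open>For a bridge \<eta>x the summand \<open>gen k\<close> falls into m or into n. If into n,
  a factorisation of \<eta> suffices. If into m, \<eta> is factored as \<mu>\<nu> and surjectivity
  of \<open>\<phi>\<close> rewrites \<nu>x as y\<gamma>, giving the factors \<mu>y and
  \<gamma>.\<close>

lemma link_factorisation_exists:
  assumes "f \<in> mor (link_graph k \<Lambda> \<Gamma> X)" and deg: "deg (link_graph k \<Lambda> \<Gamma> X) f = m + n"
  shows "\<exists>g\<in>mor (link_graph k \<Lambda> \<Gamma> X). \<exists>h\<in>mor (link_graph k \<Lambda> \<Gamma> X).
    deg (link_graph k \<Lambda> \<Gamma> X) g = m \<and> deg (link_graph k \<Lambda> \<Gamma> X) h = n \<and>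
    src (link_graph k \<Lambda> \<Gamma> X) g = rng (link_graph k \<Lambda> \<Gamma> X) h \<and> f = cmp (link_graph k \<Lambda> \<Gamma> X) g h"
  using assms(1)
proof (cases rule: mor_linkE)
  case (Lft \<eta>)
  with deg obtain \<mu> \<nu> where "\<mu> \<in> mor \<Lambda>" "\<nu> \<in> mor \<Lambda>" "deg \<Lambda> \<mu> = m" "deg \<Lambda> \<nu> = n"
    "src \<Lambda> \<mu> = rng \<Lambda> \<nu>" "\<eta> = cmp \<Lambda> \<mu> \<nu>" by (auto elim: L.factorisation_exists)
  then show ?thesis using Lft by (intro bexI[of _ "Lft \<mu>"] bexI[of _ "Lft \<nu>"]) auto
next
  case (Rgt \<gamma>)
  with deg obtain \<mu> \<nu> where "\<mu> \<in> mor \<Gamma>" "\<nu> \<in> mor \<Gamma>" "deg \<Gamma> \<mu> = m" "deg \<Gamma> \<nu> = n"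
    "src \<Gamma> \<mu> = rng \<Gamma> \<nu>" "\<gamma> = cmp \<Gamma> \<mu> \<nu>" by (auto elim: G.factorisation_exists)
  then show ?thesis using Rgt by (intro bexI[of _ "Rgt \<mu>"] bexI[of _ "Rgt \<nu>"]) auto
next
  case (Bridge \<eta> x)
  have mn: "deg \<Lambda> \<eta> + gen k = m + n" using Bridge deg by simp
  have "m \<in> Nat_pow (Suc k)" "n \<in> Nat_pow (Suc k)"
    using deg_link_Nat_pow[OF assms(1)] by (simp_all only: deg add_Nat_pow)
  \<comment> \<open>The degree of \<eta> vanishes in the last coordinate, so the total there is that
    of \<open>gen k\<close>.\<close>
  moreover have "(m + n) k = 1"
    using Bridge(2) by (simp flip: mn add: Nat_pow_top[OF L.deg_Nat_pow])
  then consider "n k = 1" | "m k = 1" by (auto simp: add_is_1)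
  ultimately consider n' where "n = n' + gen k" | m' where "m = m' + gen k"
    by (metis Nat_pow_split_gen zero_neq_one)
  then show ?thesis
  proof cases
    case 1
    then have "deg \<Lambda> \<eta> = m + n'" using mn by (simp flip: add.assoc)
    from L.factorisation_exists[OF Bridge(2) this] obtain \<mu> \<nu> where
      "\<mu> \<in> mor \<Lambda>" "\<nu> \<in> mor \<Lambda>" "deg \<Lambda> \<mu> = m" "deg \<Lambda> \<nu> = n'" "src \<Lambda> \<mu> = rng \<Lambda> \<nu>" "\<eta> = cmp \<Lambda> \<mu> \<nu>" .
    then show ?thesis
      using Bridge 1 by (intro bexI[of _ "Lft \<mu>"] bexI[of _ "Bridge \<nu> x"]) (auto simp: L.src_cmp)
  next
    case 2
    then have "deg \<Lambda> \<eta> + gen k = m' + n + gen k" using mn by (metis add.assoc add.commute)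
    then have "deg \<Lambda> \<eta> = m' + n" by simp
    from L.factorisation_exists[OF Bridge(2) this] obtain \<mu> \<nu> where
      f: "\<mu> \<in> mor \<Lambda>" "\<nu> \<in> mor \<Lambda>" "deg \<Lambda> \<mu> = m'" "deg \<Lambda> \<nu> = n" "src \<Lambda> \<mu> = rng \<Lambda> \<nu>" "\<eta> = cmp \<Lambda> \<mu> \<nu>" .
    then have "src \<Lambda> \<nu> = mrng X x" using Bridge by (simp add: L.src_cmp)
    from phi_surj[OF f(2) Bridge(3) this] obtain y \<gamma> where
      p: "y \<in> carrier X" "\<gamma> \<in> mor \<Gamma>" "msrc X y = rng \<Gamma> \<gamma>" "phi X (y, \<gamma>) = (\<nu>, x)" .
    show ?thesis
      using Bridge 2 f p phiD[OF p] by (intro bexI[of _ "Bridge \<mu> y"] bexI[of _ "Rgt \<gamma>"]) auto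
  qed
qed

text \<open>The composite shows whether a bridge occurs, and \<open>deg_link_top\<close> shows in
  which factor, so both pairs have the same shape. For a bridge followed by a \<Gamma>-path,
  cancellation in \<Lambda> and the common X-component determine the value of \<open>\<phi>\<close>,
  and injectivity of \<open>\<phi>\<close> recovers its argument.\<close>

lemma link_factorisation_unique:
  assumes "g \<in> mor (link_graph k \<Lambda> \<Gamma> X)" "h \<in> mor (link_graph k \<Lambda> \<Gamma> X)"
    "src (link_graph k \<Lambda> \<Gamma> X) g = rng (link_graph k \<Lambda> \<Gamma> X) h"
    and "g' \<in> mor (link_graph k \<Lambda> \<Gamma> X)" "h' \<in> mor (link_graph k \<Lambda> \<Gamma> X)"
    "src (link_graph k \<Lambda> \<Gamma> X) g' = rng (link_graph k \<Lambda> \<Gamma> X) h'"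
    and deg: "deg (link_graph k \<Lambda> \<Gamma> X) g = deg (link_graph k \<Lambda> \<Gamma> X) g'"
    "deg (link_graph k \<Lambda> \<Gamma> X) h = deg (link_graph k \<Lambda> \<Gamma> X) h'"
    and cmp: "cmp (link_graph k \<Lambda> \<Gamma> X) g h = cmp (link_graph k \<Lambda> \<Gamma> X) g' h'"
  shows "g = g' \<and> h = h'"
proof -
  have top: "(case g of Bridge _ _ \<Rightarrow> True | _ \<Rightarrow> False) = (case g' of Bridge _ _ \<Rightarrow> True | _ \<Rightarrow> False)"
    using deg_link_top[OF assms(1)] deg_link_top[OF assms(4)] deg(1)
    by (auto split: link.splits)
  from assms(1-3) show ?thesis
  proof (cases rule: composable_linkE)
    case 1: (Lft_Lft \<mu> \<nu>)
    from assms(4-6) show ?thesis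
    proof (cases rule: composable_linkE)
      case 2: (Lft_Lft \<mu>' \<nu>')
      have "deg \<Lambda> \<mu> = deg \<Lambda> \<mu>'" "deg \<Lambda> \<nu> = deg \<Lambda> \<nu>'" "cmp \<Lambda> \<mu> \<nu> = cmp \<Lambda> \<mu>' \<nu>'"
        using 1 2 deg cmp by simp_all
      from L.factorisation_unique[OF 1(3-5) 2(3-5) this] show ?thesis using 1 2 by simp
    qed (use 1 cmp top in auto)
  next
    case 1: (Rgt_Rgt \<mu> \<nu>)
    from assms(4-6) show ?thesis
    proof (cases rule: composable_linkE)
      case 2: (Rgt_Rgt \<mu>' \<nu>')
      have "deg \<Gamma> \<mu> = deg \<Gamma> \<mu>'" "deg \<Gamma> \<nu> = deg \<Gamma> \<nu>'" "cmp \<Gamma> \<mu> \<nu> = cmp \<Gamma> \<mu>' \<nu>'"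
        using 1 2 deg cmp by simp_all
      from G.factorisation_unique[OF 1(3-5) 2(3-5) this] show ?thesis using 1 2 by simp
    qed (use 1 cmp top in auto)
  next
    case 1: (Lft_Bridge \<mu> \<eta> x)
    from assms(4-6) show ?thesis
    proof (cases rule: composable_linkE)
      case 2: (Lft_Bridge \<mu>' \<eta>' x')
      have "deg \<Lambda> \<mu> = deg \<Lambda> \<mu>'" "deg \<Lambda> \<eta> = deg \<Lambda> \<eta>'" "cmp \<Lambda> \<mu> \<eta> = cmp \<Lambda> \<mu>' \<eta>'" "x = x'"
        using 1 2 deg cmp by simp_all
      from L.factorisation_unique[OF 1(3-5) 2(3-5) this(1-3)] this(4) show ?thesis using 1 2 by simp
    qed (use 1 cmp top in auto)
  next
    case 1: (Bridge_Rgt \<eta> x \<gamma> \<mu> y)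
    from assms(4-6) show ?thesis
    proof (cases rule: composable_linkE)
      case 2: (Bridge_Rgt \<eta>' x' \<gamma>' \<mu>' y')
      have "src \<Lambda> \<eta> = rng \<Lambda> \<mu>" "src \<Lambda> \<eta>' = rng \<Lambda> \<mu>'" using 1 2 by simp_all
      note u = L.factorisation_unique[OF 1(3,9) this(1) 2(3,9) this(2)]
      have "deg \<Lambda> \<eta> = deg \<Lambda> \<eta>'" "deg \<Lambda> \<mu> = deg \<Lambda> \<mu>'" "cmp \<Lambda> \<eta> \<mu> = cmp \<Lambda> \<eta>' \<mu>'" "y = y'"
        using 1 2 deg cmp by simp_all
      note e = u[OF this(1-3)] this(4)
      have "x = x'" "\<gamma> = \<gamma>'"
        using phi_inj[OF 1(4,6,7) 2(4,6,7)] 1(8) 2(8) e by simp_all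
      then show ?thesis using 1 2 e by simp
    qed (use 1 cmp top in auto)
  qed
qed

lemma k_graph_link: "k_graph (Suc k) (link_graph k \<Lambda> \<Gamma> X)"
proof (rule k_graphI[OF small_category_link])
  show "mor (link_graph k \<Lambda> \<Gamma> X) \<noteq> {}" using L.nonempty by (simp add: link_graph_def)
  have "countable (left_fibre \<Lambda> X)"
    by (rule countable_subset[of _ "mor \<Lambda> \<times> carrier X"])
      (auto simp: left_fibre_def L.countable_mor countable_carrier)
  then show "countable (mor (link_graph k \<Lambda> \<Gamma> X))"
    using L.countable_mor G.countable_mor by (simp add: link_graph_def)
  fix f assume f: "f \<in> mor (link_graph k \<Lambda> \<Gamma> X)"
  show "deg (link_graph k \<Lambda> \<Gamma> X) (rng (link_graph k \<Lambda> \<Gamma> X) f) = 0"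
    "deg (link_graph k \<Lambda> \<Gamma> X) (src (link_graph k \<Lambda> \<Gamma> X) f) = 0"
    using f by (auto elim!: mor_linkE simp: L.deg_rng G.deg_rng L.deg_src G.deg_src)
next
  fix f g assume "f \<in> mor (link_graph k \<Lambda> \<Gamma> X)" "g \<in> mor (link_graph k \<Lambda> \<Gamma> X)"
    "src (link_graph k \<Lambda> \<Gamma> X) f = rng (link_graph k \<Lambda> \<Gamma> X) g"
  then show "deg (link_graph k \<Lambda> \<Gamma> X) (cmp (link_graph k \<Lambda> \<Gamma> X) f g) =
    deg (link_graph k \<Lambda> \<Gamma> X) f + deg (link_graph k \<Lambda> \<Gamma> X) g"
    by (cases rule: composable_linkE) (auto simp: L.deg_cmp G.deg_cmp add_ac)
qed (fact deg_link_Nat_pow link_factorisation_exists link_factorisation_unique)+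

end

section \<open>Linking graphs as extensions of \<open>\<Lambda> \<squnion> \<Gamma>\<close>\<close>

text \<open>The first three conditions of \<open>linking_graph\<close>; degrees are compared directly because
  \<open>iota k\<close> is the identity on \<open>Nat_pow k\<close>.\<close>

locale bridged_sum = L: k_graph k \<Lambda> + G: k_graph k \<Gamma> + S: k_graph "Suc k" \<Sigma>
  for k :: nat and \<Lambda> :: "'a graph" and \<Gamma> :: "'b graph" and \<Sigma> :: "'c graph" +
  fixes i :: "'a + 'b \<Rightarrow> 'c"
  assumes functor_i: "is_functor (graph_sum \<Lambda> \<Gamma>) \<Sigma> i"
    and deg_i_sum: "z \<in> mor (graph_sum \<Lambda> \<Gamma>) \<Longrightarrow> deg \<Sigma> (i z) = deg (graph_sum \<Lambda> \<Gamma>) z"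
    and bij_i: "bij_betw i (mor (graph_sum \<Lambda> \<Gamma>)) {\<sigma> \<in> mor \<Sigma>. deg \<Sigma> \<sigma> \<in> Nat_pow k}"
    and bridge_ends: "\<alpha> \<in> grade \<Sigma> (gen k) \<Longrightarrow>
      src \<Sigma> \<alpha> \<in> i ` Inr ` grade \<Gamma> 0 \<and> rng \<Sigma> \<alpha> \<in> i ` Inl ` grade \<Lambda> 0"

lemma deg_graph_sum_Nat_pow:
  assumes "k_graph k \<Lambda>" "k_graph k \<Gamma>" "z \<in> mor (graph_sum \<Lambda> \<Gamma>)"
  shows "deg (graph_sum \<Lambda> \<Gamma>) z \<in> Nat_pow k"
  using assms by (auto simp: graph_sum_def k_graph.deg_Nat_pow)

text \<open>As \<open>\<iota>\<close> is an inclusion, \<open>iota_part\<close> merely restricts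
  \<Sigma> to the paths with degree in \<open>Nat_pow k\<close>. The quasimorphism and the
  isomorphism then impose the same functoriality and degree conditions, and the bijection is what
  the isomorphism adds.\<close>

lemma linking_graph_iff_bridged_sum:
  assumes \<Lambda>: "k_graph k \<Lambda>" and \<Gamma>: "k_graph k \<Gamma>"
  shows "linking_graph k \<Lambda> \<Gamma> X \<Sigma> i \<longleftrightarrow>
    bridged_sum k \<Lambda> \<Gamma> \<Sigma> i \<and> (\<exists>\<theta>. morph_iso \<Gamma> (morph_of k \<Lambda> \<Gamma> \<Sigma> i) X \<theta>)"
proof -
  let ?S = "graph_sum \<Lambda> \<Gamma>"
  note Np = deg_graph_sum_Nat_pow[OF assms]
  have "inj_on (iota k) (Nat_pow k)" by (auto simp: inj_on_def iota_id)
  then have inv: "the_inv_into (Nat_pow k) (iota k) n = n" if "n \<in> Nat_pow k" for n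
    using the_inv_into_f_f[of "iota k" "Nat_pow k" n] that by (simp add: iota_id)
  have mor: "mor (iota_part k \<Sigma>) = {\<sigma> \<in> mor \<Sigma>. deg \<Sigma> \<sigma> \<in> Nat_pow k}"
    by (auto simp: iota_part_def grade_def iota_id)
  have sel: "rng (iota_part k \<Sigma>) = rng \<Sigma>" "src (iota_part k \<Sigma>) = src \<Sigma>" "cmp (iota_part k \<Sigma>) = cmp \<Sigma>"
    "deg \<Sigma> \<sigma> \<in> Nat_pow k \<Longrightarrow> deg (iota_part k \<Sigma>) \<sigma> = deg \<Sigma> \<sigma>" for \<sigma>
    by (simp_all add: iota_part_def inv)
  have "quasimorphism k ?S \<Sigma> i \<and> graph_iso ?S (iota_part k \<Sigma>) i \<longleftrightarrow>
    is_functor ?S \<Sigma> i \<and> (\<forall>z\<in>mor ?S. deg \<Sigma> (i z) = deg ?S z) \<and>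
    bij_betw i (mor ?S) {\<sigma> \<in> mor \<Sigma>. deg \<Sigma> \<sigma> \<in> Nat_pow k}"
    using Np by (auto simp: quasimorphism_def graph_iso_def is_functor_def mor sel iota_id)
  then show ?thesis
    using assms by (auto simp: linking_graph_def bridged_sum_def bridged_sum_axioms_def)
qed

section \<open>Crossing paths in a graph extending \<Lambda> and \<Gamma>\<close>

context bridged_sum
begin

lemma i_mor:
  assumes "z \<in> mor (graph_sum \<Lambda> \<Gamma>)"
  shows "i z \<in> mor \<Sigma>" "rng \<Sigma> (i z) = i (rng (graph_sum \<Lambda> \<Gamma>) z)"
    "src \<Sigma> (i z) = i (src (graph_sum \<Lambda> \<Gamma>) z)" "deg \<Sigma> (i z) = deg (graph_sum \<Lambda> \<Gamma>) z"
  using functor_i deg_i_sum assms by (simp_all add: is_functor_def)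

lemma i_Inl:
  assumes "\<eta> \<in> mor \<Lambda>"
  shows "i (Inl \<eta>) \<in> mor \<Sigma>" "rng \<Sigma> (i (Inl \<eta>)) = i (Inl (rng \<Lambda> \<eta>))"
    "src \<Sigma> (i (Inl \<eta>)) = i (Inl (src \<Lambda> \<eta>))" "deg \<Sigma> (i (Inl \<eta>)) = deg \<Lambda> \<eta>"
  using i_mor[of "Inl \<eta>"] assms by (simp_all add: graph_sum_def InlI InrI)

lemma i_Inr:
  assumes "\<gamma> \<in> mor \<Gamma>"
  shows "i (Inr \<gamma>) \<in> mor \<Sigma>" "rng \<Sigma> (i (Inr \<gamma>)) = i (Inr (rng \<Gamma> \<gamma>))"
    "src \<Sigma> (i (Inr \<gamma>)) = i (Inr (src \<Gamma> \<gamma>))" "deg \<Sigma> (i (Inr \<gamma>)) = deg \<Gamma> \<gamma>"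
  using i_mor[of "Inr \<gamma>"] assms by (simp_all add: graph_sum_def InlI InrI)

lemma i_cmp:
  "\<lbrakk>\<mu> \<in> mor \<Lambda>; \<nu> \<in> mor \<Lambda>; src \<Lambda> \<mu> = rng \<Lambda> \<nu>\<rbrakk> \<Longrightarrow>
    i (Inl (cmp \<Lambda> \<mu> \<nu>)) = cmp \<Sigma> (i (Inl \<mu>)) (i (Inl \<nu>))"
  "\<lbrakk>\<mu>' \<in> mor \<Gamma>; \<nu>' \<in> mor \<Gamma>; src \<Gamma> \<mu>' = rng \<Gamma> \<nu>'\<rbrakk> \<Longrightarrow>
    i (Inr (cmp \<Gamma> \<mu>' \<nu>')) = cmp \<Sigma> (i (Inr \<mu>')) (i (Inr \<nu>'))"
  using functor_i[unfolded is_functor_def, THEN conjunct2, rule_format, of "Inl \<mu>" "Inl \<nu>"]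
    functor_i[unfolded is_functor_def, THEN conjunct2, rule_format, of "Inr \<mu>'" "Inr \<nu>'"]
  by (simp_all add: graph_sum_def InlI InrI)

lemma i_eq_iff:
  "\<lbrakk>\<eta> \<in> mor \<Lambda>; \<eta>' \<in> mor \<Lambda>\<rbrakk> \<Longrightarrow> i (Inl \<eta>) = i (Inl \<eta>') \<longleftrightarrow> \<eta> = \<eta>'"
  "\<lbrakk>\<gamma> \<in> mor \<Gamma>; \<gamma>' \<in> mor \<Gamma>\<rbrakk> \<Longrightarrow> i (Inr \<gamma>) = i (Inr \<gamma>') \<longleftrightarrow> \<gamma> = \<gamma>'"
  "\<lbrakk>\<eta> \<in> mor \<Lambda>; \<gamma> \<in> mor \<Gamma>\<rbrakk> \<Longrightarrow> i (Inl \<eta>) \<noteq> i (Inr \<gamma>)"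
  "\<lbrakk>\<eta> \<in> mor \<Lambda>; \<gamma> \<in> mor \<Gamma>\<rbrakk> \<Longrightarrow> i (Inr \<gamma>) \<noteq> i (Inl \<eta>)"
  using inj_on_eq_iff[OF bij_betw_imp_inj_on[OF bij_i]] by (auto simp: graph_sum_def)

lemma lift_i:
  assumes "\<sigma> \<in> mor \<Sigma>" "deg \<Sigma> \<sigma> \<in> Nat_pow k"
  obtains (Inl) \<eta> where "\<eta> \<in> mor \<Lambda>" "\<sigma> = i (Inl \<eta>)" | (Inr) \<gamma> where "\<gamma> \<in> mor \<Gamma>" "\<sigma> = i (Inr \<gamma>)"
proof -
  have "\<sigma> \<in> i ` (mor \<Lambda> <+> mor \<Gamma>)"
    using assms bij_betw_imp_surj_on[OF bij_i] by (simp add: graph_sum_def)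
  then show ?thesis using that by auto
qed

lemma bridge_endsE:
  assumes "\<alpha> \<in> grade \<Sigma> (gen k)"
  obtains v w where "v \<in> grade \<Lambda> 0" "v \<in> mor \<Lambda>" "rng \<Sigma> \<alpha> = i (Inl v)"
    "w \<in> grade \<Gamma> 0" "w \<in> mor \<Gamma>" "src \<Sigma> \<alpha> = i (Inr w)"
  using bridge_ends[OF assms] by (auto simp: grade_def)

text \<open>This is the normal form in an arbitrary \<Sigma>: an edge of degree \<open>gen k\<close>
  is split off on the right, and what remains is shown to come from \<Lambda>.\<close>

lemma bridge_factorisation:
  assumes \<sigma>: "\<sigma> \<in> mor \<Sigma>" "deg \<Sigma> \<sigma> \<notin> Nat_pow k"
  obtains \<eta> \<alpha> where "\<eta> \<in> mor \<Lambda>" "\<alpha> \<in> grade \<Sigma> (gen k)" "src \<Sigma> (i (Inl \<eta>)) = rng \<Sigma> \<alpha>"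
    "\<sigma> = cmp \<Sigma> (i (Inl \<eta>)) \<alpha>"
proof -
  have "deg \<Sigma> \<sigma> \<in> Nat_pow (Suc k)" by (rule S.deg_Nat_pow) fact
  moreover from this have "deg \<Sigma> \<sigma> k \<noteq> 0" using \<sigma>(2) Nat_pow_SucD by blast
  ultimately obtain m where m: "m \<in> Nat_pow (Suc k)" "deg \<Sigma> \<sigma> = m + gen k"
    by (rule Nat_pow_split_gen)
  from S.factorisation_exists[OF \<sigma>(1) m(2)] obtain \<mu> \<alpha> where
    f: "\<mu> \<in> mor \<Sigma>" "\<alpha> \<in> mor \<Sigma>" "deg \<Sigma> \<mu> = m" "deg \<Sigma> \<alpha> = gen k" "src \<Sigma> \<mu> = rng \<Sigma> \<alpha>" "\<sigma> = cmp \<Sigma> \<mu> \<alpha>" .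
  then have \<alpha>: "\<alpha> \<in> grade \<Sigma> (gen k)" by (simp add: grade_def)
  from bridge_endsE[OF this] obtain v where v: "v \<in> mor \<Lambda>" "rng \<Sigma> \<alpha> = i (Inl v)" by metis
  \<comment> \<open>Otherwise \<mu> would end in an edge \<beta> of degree \<open>gen k\<close>
    adjacent to \<alpha>, and the vertex between them would be in the image of \<Gamma> as the
    source of \<beta> and in that of \<Lambda> as the range of \<alpha>.\<close>
  have "m k = 0"
  proof (rule ccontr)
    assume "m k \<noteq> 0"
    with m(1) obtain m' where m': "m = m' + gen k" by (rule Nat_pow_split_gen)
    from S.factorisation_exists[OF f(1) f(3)[unfolded m']] obtain \<nu> \<beta> where
      g: "\<nu> \<in> mor \<Sigma>" "\<beta> \<in> mor \<Sigma>" "deg \<Sigma> \<beta> = gen k" "src \<Sigma> \<nu> = rng \<Sigma> \<beta>" "\<mu> = cmp \<Sigma> \<nu> \<beta>" .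
    then have "\<beta> \<in> grade \<Sigma> (gen k)" by (simp add: grade_def)
    from bridge_endsE[OF this] obtain w where "w \<in> mor \<Gamma>" "src \<Sigma> \<beta> = i (Inr w)" by metis
    then show False using f g v i_eq_iff(4)[of v w] by (simp add: S.src_cmp)
  qed
  with m(1) have "m \<in> Nat_pow k" by (rule Nat_pow_SucD)
  then have "deg \<Sigma> \<mu> \<in> Nat_pow k" using f by simp
  with f(1) show ?thesis
  proof (cases rule: lift_i)
    case (Inl \<eta>)
    then show ?thesis using that f \<alpha> by auto
  next
    \<comment> \<open>Excluded for the same reason: a \<Gamma>-path cannot start at the range of
      \<alpha>, which is in the image of \<Lambda>.\<close>
    case (Inr \<gamma>)
    then show ?thesis using f v i_eq_iff(4)[of v "src \<Gamma> \<gamma>"] by (simp add: i_Inr G.src_mor)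
  qed
qed

text \<open>Supplies the existence half of the description of \<open>phi\<close> in
  \<open>morph_of\<close>: the composite has positive last coordinate, so it has a normal form, and
  cancelling \<open>gen k\<close> gives the degree of \<eta>.\<close>

lemma bridge_swap:
  assumes \<alpha>: "\<alpha> \<in> grade \<Sigma> (gen k)" and \<gamma>: "\<gamma> \<in> mor \<Gamma>" "src \<Sigma> \<alpha> = i (Inr (rng \<Gamma> \<gamma>))"
  obtains \<eta> \<beta> where "\<eta> \<in> mor \<Lambda>" "deg \<Lambda> \<eta> = deg \<Gamma> \<gamma>" "\<beta> \<in> grade \<Sigma> (gen k)"
    "src \<Sigma> (i (Inl \<eta>)) = rng \<Sigma> \<beta>" "cmp \<Sigma> \<alpha> (i (Inr \<gamma>)) = cmp \<Sigma> (i (Inl \<eta>)) \<beta>"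
proof -
  let ?\<sigma> = "cmp \<Sigma> \<alpha> (i (Inr \<gamma>))"
  have a: "\<alpha> \<in> mor \<Sigma>" "deg \<Sigma> \<alpha> = gen k" using \<alpha> by (auto simp: grade_def)
  have c: "src \<Sigma> \<alpha> = rng \<Sigma> (i (Inr \<gamma>))" using \<gamma> by (simp add: i_Inr)
  have \<sigma>: "?\<sigma> \<in> mor \<Sigma>" using a \<gamma> c by (simp add: S.cmp_mor i_Inr)
  have d: "deg \<Sigma> ?\<sigma> = deg \<Gamma> \<gamma> + gen k"
    using a \<gamma> c by (simp add: S.deg_cmp i_Inr add.commute)
  then have "deg \<Sigma> ?\<sigma> \<notin> Nat_pow k" by (auto dest: Nat_pow_top)
  from bridge_factorisation[OF \<sigma> this] obtain \<eta> \<beta> where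
    f: "\<eta> \<in> mor \<Lambda>" "\<beta> \<in> grade \<Sigma> (gen k)" "src \<Sigma> (i (Inl \<eta>)) = rng \<Sigma> \<beta>"
    "?\<sigma> = cmp \<Sigma> (i (Inl \<eta>)) \<beta>" .
  moreover have "deg \<Lambda> \<eta> + gen k = deg \<Gamma> \<gamma> + gen k"
    using f d by (simp add: S.deg_cmp i_Inl grade_def)
  ultimately show ?thesis using that by simp
qed

section \<open>Evaluating the morph carried by \<Sigma>\<close>

lemma mrng_morph_of:
  assumes "v \<in> grade \<Lambda> 0" "rng \<Sigma> \<alpha> = i (Inl v)"
  shows "mrng (morph_of k \<Lambda> \<Gamma> \<Sigma> i) \<alpha> = v"
  using assms i_eq_iff(1) by (auto simp: morph_of_def grade_def intro!: the_equality)

lemma msrc_morph_of: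
  assumes "w \<in> grade \<Gamma> 0" "src \<Sigma> \<alpha> = i (Inr w)"
  shows "msrc (morph_of k \<Lambda> \<Gamma> \<Sigma> i) \<alpha> = w"
  using assms i_eq_iff(2) by (auto simp: morph_of_def grade_def intro!: the_equality)

text \<open>Uniqueness comes from cancellation in \<Sigma>, which fixes \<beta> and the image of
  \<eta>, followed by injectivity of \<open>i\<close> on \<Lambda>.\<close>

lemma phi_morph_of:
  assumes "\<eta> \<in> mor \<Lambda>" "deg \<Lambda> \<eta> = deg \<Gamma> \<gamma>" "\<beta> \<in> grade \<Sigma> (gen k)"
    "src \<Sigma> (i (Inl \<eta>)) = rng \<Sigma> \<beta>" "cmp \<Sigma> \<alpha> (i (Inr \<gamma>)) = cmp \<Sigma> (i (Inl \<eta>)) \<beta>"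
  shows "phi (morph_of k \<Lambda> \<Gamma> \<Sigma> i) (\<alpha>, \<gamma>) = (\<eta>, \<beta>)"
proof -
  let ?P = "\<lambda>p. case p of (\<eta>, \<alpha>') \<Rightarrow> \<eta> \<in> grade \<Lambda> (deg \<Gamma> \<gamma>) \<and> \<alpha>' \<in> grade \<Sigma> (gen k) \<and>
       src \<Sigma> (i (Inl \<eta>)) = rng \<Sigma> \<alpha>' \<and> cmp \<Sigma> \<alpha> (i (Inr \<gamma>)) = cmp \<Sigma> (i (Inl \<eta>)) \<alpha>'"
  have "(THE p. ?P p) = (\<eta>, \<beta>)"
  proof (rule the_equality)
    show "?P (\<eta>, \<beta>)" using assms by (simp add: grade_def)
  next
    fix p assume p: "?P p"
    obtain \<eta>' \<beta>' where p_eq: "p = (\<eta>', \<beta>')" by fastforce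
    have "i (Inl \<eta>') = i (Inl \<eta>)" "\<beta>' = \<beta>"
      using S.factorisation_unique[of "i (Inl \<eta>')" \<beta>' "i (Inl \<eta>)" \<beta>] p assms
      by (simp_all add: p_eq grade_def i_Inl)
    then show "p = (\<eta>, \<beta>)" using p assms(1) by (simp add: p_eq grade_def i_eq_iff)
  qed
  then show ?thesis by (simp add: morph_of_def)
qed

end

text \<open>\<open>j\<close> is the inverse of an isomorphism from \<open>morph_of k \<Lambda> \<Gamma> \<Sigma> i\<close> to \<open>X\<close>, with the
  intertwining conditions expressed as equations in \<open>\<Sigma>\<close>.\<close>

locale linking = graph_morph k \<Lambda> \<Gamma> X + bridged_sum k \<Lambda> \<Gamma> \<Sigma> i
  for k :: nat and \<Lambda> :: "'a graph" and \<Gamma> :: "'b graph" and X :: "('x, 'a, 'b) morph"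
    and \<Sigma> :: "'c graph" and i :: "'a + 'b \<Rightarrow> 'c" +
  fixes j :: "'x \<Rightarrow> 'c"
  assumes bij_j: "bij_betw j (carrier X) (grade \<Sigma> (gen k))"
    and rng_j: "x \<in> carrier X \<Longrightarrow> rng \<Sigma> (j x) = i (Inl (mrng X x))"
    and src_j: "x \<in> carrier X \<Longrightarrow> src \<Sigma> (j x) = i (Inr (msrc X x))"
    and cmp_j: "\<lbrakk>x \<in> carrier X; \<gamma> \<in> mor \<Gamma>; msrc X x = rng \<Gamma> \<gamma>; phi X (x, \<gamma>) = (\<eta>, y)\<rbrakk> \<Longrightarrow>
      cmp \<Sigma> (j x) (i (Inr \<gamma>)) = cmp \<Sigma> (i (Inl \<eta>)) (j y)"

text \<open>The maps \<open>\<theta>\<close> and \<open>j\<close> are mutually inverse. From left to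
  right, \<open>bridge_swap\<close> produces the pair that \<open>phi_morph_of\<close> identifies as
  the value of \<open>\<phi>\<close>, and intertwining matches it with that in X. Conversely,
  \<open>cmp_j\<close> is the equation that \<open>phi_morph_of\<close> asks for.\<close>

lemma linking_graph_iff_linking:
  assumes "k_graph k \<Lambda>" "k_graph k \<Gamma>" "k_morph \<Lambda> \<Gamma> X"
  shows "linking_graph k \<Lambda> \<Gamma> X \<Sigma> i \<longleftrightarrow> (\<exists>j. linking k \<Lambda> \<Gamma> X \<Sigma> i j)"
proof
  assume "linking_graph k \<Lambda> \<Gamma> X \<Sigma> i"
  then obtain \<theta> where "bridged_sum k \<Lambda> \<Gamma> \<Sigma> i" and \<theta>: "morph_iso \<Gamma> (morph_of k \<Lambda> \<Gamma> \<Sigma> i) X \<theta>"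
    using linking_graph_iff_bridged_sum assms by blast
  interpret bridged_sum k \<Lambda> \<Gamma> \<Sigma> i by fact
  interpret graph_morph k \<Lambda> \<Gamma> X by (intro graph_morph.intro assms)
  let ?Y = "morph_of k \<Lambda> \<Gamma> \<Sigma> i"
  define j where "j = inv_into (grade \<Sigma> (gen k)) \<theta>"
  have car: "carrier ?Y = grade \<Sigma> (gen k)" by (simp add: morph_of_def)
  have bij: "bij_betw \<theta> (grade \<Sigma> (gen k)) (carrier X)" using \<theta> by (simp add: morph_iso_def car)
  have bij_j: "bij_betw j (carrier X) (grade \<Sigma> (gen k))"
    unfolding j_def by (rule bij_betw_inv_into[OF bij])
  have j: "j x \<in> grade \<Sigma> (gen k)" "\<theta> (j x) = x" if "x \<in> carrier X" for x
    using that bij bij_j by (auto simp: bij_betw_apply j_def bij_betw_inv_into_right)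
  have j\<theta>: "j (\<theta> \<alpha>) = \<alpha>" if "\<alpha> \<in> grade \<Sigma> (gen k)" for \<alpha>
    using bij_betw_inv_into_left[OF bij that] by (simp add: j_def)
  have rng_j: "rng \<Sigma> (j x) = i (Inl (mrng X x))" and src_j: "src \<Sigma> (j x) = i (Inr (msrc X x))"
    if x: "x \<in> carrier X" for x
  proof -
    have "mrng X x = mrng ?Y (j x)" "msrc X x = msrc ?Y (j x)"
      using \<theta> j[OF x] by (auto simp: morph_iso_def car)
    then show "rng \<Sigma> (j x) = i (Inl (mrng X x))" "src \<Sigma> (j x) = i (Inr (msrc X x))"
      using bridge_endsE[OF j(1)[OF x]] mrng_morph_of msrc_morph_of by metis+
  qed
  have "cmp \<Sigma> (j x) (i (Inr \<gamma>)) = cmp \<Sigma> (i (Inl \<eta>)) (j y)"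
    if x: "x \<in> carrier X" and \<gamma>: "\<gamma> \<in> mor \<Gamma>" "msrc X x = rng \<Gamma> \<gamma>" and p: "phi X (x, \<gamma>) = (\<eta>, y)"
    for x \<gamma> \<eta> y
  proof -
    have "src \<Sigma> (j x) = i (Inr (rng \<Gamma> \<gamma>))" using src_j[OF x] \<gamma> by simp
    from bridge_swap[OF j(1)[OF x] \<gamma>(1) this] obtain \<eta>' \<beta> where
      f: "\<eta>' \<in> mor \<Lambda>" "deg \<Lambda> \<eta>' = deg \<Gamma> \<gamma>" "\<beta> \<in> grade \<Sigma> (gen k)"
      "src \<Sigma> (i (Inl \<eta>')) = rng \<Sigma> \<beta>" "cmp \<Sigma> (j x) (i (Inr \<gamma>)) = cmp \<Sigma> (i (Inl \<eta>')) \<beta>" .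
    have "msrc ?Y (j x) = msrc X x" using \<theta> j[OF x] by (auto simp: morph_iso_def car)
    then have "(j x, \<gamma>) \<in> right_fibre \<Gamma> ?Y" using j[OF x] \<gamma> by (simp add: right_fibre_def car)
    then have "map_prod id \<theta> (phi ?Y (j x, \<gamma>)) = phi X (x, \<gamma>)"
      using \<theta> j[OF x] by (auto simp: morph_iso_def)
    then have "\<eta> = \<eta>'" "y = \<theta> \<beta>" using phi_morph_of[OF f] p by auto
    then show ?thesis using f j\<theta> by simp
  qed
  then have "linking k \<Lambda> \<Gamma> X \<Sigma> i j"
    by (unfold_locales) (use bij_j rng_j src_j in auto)
  then show "\<exists>j. linking k \<Lambda> \<Gamma> X \<Sigma> i j" by (rule exI[of _ j])
next
  assume "\<exists>j. linking k \<Lambda> \<Gamma> X \<Sigma> i j"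
  then obtain j where "linking k \<Lambda> \<Gamma> X \<Sigma> i j" ..
  then interpret linking k \<Lambda> \<Gamma> X \<Sigma> i j .
  let ?Y = "morph_of k \<Lambda> \<Gamma> \<Sigma> i"
  let ?\<theta> = "inv_into (carrier X) j"
  have car: "carrier ?Y = grade \<Sigma> (gen k)" by (simp add: morph_of_def)
  have bij: "bij_betw ?\<theta> (carrier ?Y) (carrier X)"
    unfolding car by (rule bij_betw_inv_into[OF bij_j])
  have jm: "j x \<in> grade \<Sigma> (gen k)" "?\<theta> (j x) = x" if "x \<in> carrier X" for x
    using that bij_j by (auto simp: bij_betw_apply bij_betw_inv_into_left)
  have ends: "mrng ?Y (j x) = mrng X x" "msrc ?Y (j x) = msrc X x" if "x \<in> carrier X" for x
    using that mrng_vertex msrc_vertex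
    by (auto intro!: mrng_morph_of msrc_morph_of simp: rng_j src_j)
  have ex: "\<exists>x\<in>carrier X. \<alpha> = j x" if "\<alpha> \<in> carrier ?Y" for \<alpha>
    using that bij_betw_imp_surj_on[OF bij_j] by (auto simp: car)
  have "map_prod id ?\<theta> (phi ?Y p) = phi X (map_prod ?\<theta> id p)" if "p \<in> right_fibre \<Gamma> ?Y" for p
  proof -
    from that obtain x \<gamma> where x: "p = (j x, \<gamma>)" "x \<in> carrier X" "\<gamma> \<in> mor \<Gamma>" "msrc X x = rng \<Gamma> \<gamma>"
      using ex ends by (fastforce simp: right_fibre_def)
    obtain \<eta> y where p: "phi X (x, \<gamma>) = (\<eta>, y)" by fastforce
    note P = phiD[OF x(2-4) p]
    have "phi ?Y (j x, \<gamma>) = (\<eta>, j y)"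
      by (rule phi_morph_of) (use P jm cmp_j[OF x(2-4) p] in \<open>auto simp: i_Inl rng_j\<close>)
    then show ?thesis using x p P jm by simp
  qed
  then have "morph_iso \<Gamma> ?Y X ?\<theta>"
    using bij ex ends jm by (fastforce simp: morph_iso_def)
  then show "linking_graph k \<Lambda> \<Gamma> X \<Sigma> i"
    using linking_graph_iff_bridged_sum assms bridged_sum_axioms by blast
qed

section \<open>Comparison of the canonical model with an arbitrary linking graph\<close>

context linking
begin

text \<open>No other functor agrees with \<open>i\<close> on \<Lambda> and \<Gamma> and sends
  \<open>Bridge (mrng X x) x\<close> to \<open>j x\<close>, because \<open>Bridge \<eta> x\<close>
  is the composite of \<open>Lft \<eta>\<close> with that bridge.\<close>

definition comparison :: "('a, 'b, 'x) link \<Rightarrow> 'c"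
  where "comparison = case_link (\<lambda>\<eta>. i (Inl \<eta>)) (\<lambda>\<gamma>. i (Inr \<gamma>)) (\<lambda>\<eta> x. cmp \<Sigma> (i (Inl \<eta>)) (j x))"

lemma comparison_simps [simp]:
  "comparison (Lft \<eta>) = i (Inl \<eta>)" "comparison (Rgt \<gamma>) = i (Inr \<gamma>)"
  "comparison (Bridge \<eta> x) = cmp \<Sigma> (i (Inl \<eta>)) (j x)"
  by (simp_all add: comparison_def)

lemma j_mor:
  assumes "x \<in> carrier X"
  shows "j x \<in> mor \<Sigma>" "deg \<Sigma> (j x) = gen k"
  using bij_betw_apply[OF bij_j assms] by (auto simp: grade_def)

lemmas Sigma_simps = i_Inl i_Inr i_cmp i_eq_iff j_mor rng_j src_j
  L.rng_mor L.src_mor G.rng_mor G.src_mor L.cmp_mor G.cmp_mor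
  S.cmp_mor S.rng_cmp S.src_cmp S.deg_cmp L.rng_cmp L.src_cmp

lemma comparison_preserves:
  assumes "f \<in> mor (link_graph k \<Lambda> \<Gamma> X)"
  shows "comparison f \<in> mor \<Sigma>"
    "rng \<Sigma> (comparison f) = comparison (rng (link_graph k \<Lambda> \<Gamma> X) f)"
    "src \<Sigma> (comparison f) = comparison (src (link_graph k \<Lambda> \<Gamma> X) f)"
    "deg \<Sigma> (comparison f) = deg (link_graph k \<Lambda> \<Gamma> X) f"
  using assms by (auto elim!: mor_linkE simp: Sigma_simps)

text \<open>Only a bridge followed by a \<Gamma>-path involves \<open>\<phi>\<close>; there
  \<open>cmp_j\<close> moves the \<Gamma>-path across \<open>j x\<close>, between two reassociations
  in \<Sigma>.\<close>

lemma comparison_cmp: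
  assumes "f \<in> mor (link_graph k \<Lambda> \<Gamma> X)" "g \<in> mor (link_graph k \<Lambda> \<Gamma> X)"
    "src (link_graph k \<Lambda> \<Gamma> X) f = rng (link_graph k \<Lambda> \<Gamma> X) g"
  shows "comparison (cmp (link_graph k \<Lambda> \<Gamma> X) f g) = cmp \<Sigma> (comparison f) (comparison g)"
  using assms
proof (cases rule: composable_linkE)
  case (Bridge_Rgt \<eta> x \<gamma> \<mu> y)
  let ?l = "\<lambda>\<eta>. i (Inl \<eta>)" and ?r = "\<lambda>\<gamma>. i (Inr \<gamma>)"
  have "cmp \<Sigma> (?l (cmp \<Lambda> \<eta> \<mu>)) (j y) = cmp \<Sigma> (?l \<eta>) (cmp \<Sigma> (?l \<mu>) (j y))"
    using Bridge_Rgt by (simp add: Sigma_simps S.cmp_assoc)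
  also have "\<dots> = cmp \<Sigma> (?l \<eta>) (cmp \<Sigma> (j x) (?r \<gamma>))"
    using cmp_j[OF Bridge_Rgt(4,6-8)] by simp
  also have "\<dots> = cmp \<Sigma> (cmp \<Sigma> (?l \<eta>) (j x)) (?r \<gamma>)"
    using Bridge_Rgt by (simp add: Sigma_simps S.cmp_assoc)
  finally show ?thesis using Bridge_Rgt by simp
qed (simp_all add: Sigma_simps S.cmp_assoc)

text \<open>Degrees keep bridges apart from the other paths. On bridges, injectivity is cancellation
  in \<Sigma> and surjectivity is \<open>bridge_factorisation\<close>; elsewhere both are properties
  of \<open>i\<close>.\<close>

lemma graph_iso_comparison: "graph_iso (link_graph k \<Lambda> \<Gamma> X) \<Sigma> comparison"
proof -
  let ?C = "link_graph k \<Lambda> \<Gamma> X"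
  have "inj_on comparison (mor ?C)"
  proof (rule inj_onI)
    fix f g assume fg: "f \<in> mor ?C" "g \<in> mor ?C" and eq: "comparison f = comparison g"
    then have d: "deg ?C f = deg ?C g" using comparison_preserves(4) by metis
    then have top: "(case f of Bridge _ _ \<Rightarrow> True | _ \<Rightarrow> False) = (case g of Bridge _ _ \<Rightarrow> True | _ \<Rightarrow> False)"
      using deg_link_top[OF fg(1)] deg_link_top[OF fg(2)] by (auto split: link.splits)
    from fg(1) show "f = g"
    proof (cases rule: mor_linkE)
      case f: (Bridge \<eta> x)
      with top fg(2) obtain \<eta>' x' where
        g: "g = Bridge \<eta>' x'" "\<eta>' \<in> mor \<Lambda>" "x' \<in> carrier X" "src \<Lambda> \<eta>' = mrng X x'"
        by (auto elim!: mor_linkE)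
      have "i (Inl \<eta>) = i (Inl \<eta>')" "j x = j x'"
        using S.factorisation_unique[of "i (Inl \<eta>)" "j x" "i (Inl \<eta>')" "j x'"] f g eq d
        by (simp_all add: Sigma_simps)
      then show ?thesis
        using f g bij_betw_imp_inj_on[OF bij_j] by (simp add: i_eq_iff inj_on_eq_iff)
    qed (use fg(2) top eq in \<open>auto elim!: mor_linkE simp: i_eq_iff\<close>)
  qed
  moreover have "comparison ` mor ?C = mor \<Sigma>"
  proof (intro equalityI subsetI)
    fix \<sigma> assume \<sigma>: "\<sigma> \<in> mor \<Sigma>"
    show "\<sigma> \<in> comparison ` mor ?C"
    proof (cases "deg \<Sigma> \<sigma> \<in> Nat_pow k")
      case True
      with \<sigma> show ?thesis
      proof (cases rule: lift_i)
        case (Inl \<eta>)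
        then show ?thesis by (intro image_eqI[of _ _ "Lft \<eta>"]) auto
      next
        case (Inr \<gamma>)
        then show ?thesis by (intro image_eqI[of _ _ "Rgt \<gamma>"]) auto
      qed
    next
      case False
      with \<sigma> obtain \<eta> \<alpha> where f: "\<eta> \<in> mor \<Lambda>" "\<alpha> \<in> grade \<Sigma> (gen k)"
        "src \<Sigma> (i (Inl \<eta>)) = rng \<Sigma> \<alpha>" "\<sigma> = cmp \<Sigma> (i (Inl \<eta>)) \<alpha>" by (rule bridge_factorisation)
      obtain x where x: "x \<in> carrier X" "\<alpha> = j x"
        using f(2) bij_betw_imp_surj_on[OF bij_j] by blast
      have "src \<Lambda> \<eta> = mrng X x" using f x by (simp add: Sigma_simps)
      then show ?thesis using f x by (intro image_eqI[of _ _ "Bridge \<eta> x"]) auto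
    qed
  qed (auto simp: comparison_preserves(1))
  ultimately show ?thesis
    using comparison_preserves comparison_cmp
    by (simp add: graph_iso_def is_functor_def bij_betw_def del: link_graph_sel)
qed

text \<open>Being a linking graph is invariant under isomorphism, so the canonical model may be
  replaced by a relabelled copy.\<close>

lemma linking_transport:
  assumes "k_graph (Suc k) \<Delta>" and F: "graph_iso \<Sigma> \<Delta> F"
  shows "linking k \<Lambda> \<Gamma> X \<Delta> (F \<circ> i) (F \<circ> j)"
proof -
  interpret D: k_graph "Suc k" \<Delta> by fact
  note F = graph_isoD[OF F]
  \<comment> \<open>Left general in P to serve twice: for degrees in \<open>Nat_pow k\<close> and
    for the single degree \<open>gen k\<close>.\<close>
  have restr: "bij_betw F {\<sigma> \<in> mor \<Sigma>. P (deg \<Sigma> \<sigma>)} {\<delta> \<in> mor \<Delta>. P (deg \<Delta> \<delta>)}" for P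
    by (rule bij_betw_subset[OF F(1)])
      (auto simp: F(5) simp flip: bij_betw_imp_surj_on[OF F(1)])
  have "bij_betw (F \<circ> i) (mor (graph_sum \<Lambda> \<Gamma>)) {\<delta> \<in> mor \<Delta>. deg \<Delta> \<delta> \<in> Nat_pow k}"
    by (rule bij_betw_trans[OF bij_i restr])
  moreover have bj: "bij_betw (F \<circ> j) (carrier X) (grade \<Delta> (gen k))"
    using bij_betw_trans[OF bij_j] restr[of "\<lambda>n. n = gen k"] by (simp add: grade_def)
  moreover have "is_functor (graph_sum \<Lambda> \<Gamma>) \<Delta> (F \<circ> i)"
    using functor_i assms(2) by (simp add: is_functor_comp graph_iso_def)
  moreover have "src \<Delta> \<alpha> \<in> (F \<circ> i) ` Inr ` grade \<Gamma> 0 \<and> rng \<Delta> \<alpha> \<in> (F \<circ> i) ` Inl ` grade \<Lambda> 0"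
    if "\<alpha> \<in> grade \<Delta> (gen k)" for \<alpha>
  proof -
    have "\<alpha> \<in> (F \<circ> j) ` carrier X" unfolding bij_betw_imp_surj_on[OF bj] by (rule that)
    then obtain x where x: "x \<in> carrier X" "\<alpha> = F (j x)" by auto
    then show ?thesis using mrng_vertex[OF x(1)] msrc_vertex[OF x(1)] by (simp add: F j_mor rng_j src_j)
  qed
  moreover have "cmp \<Delta> (F (j x)) (F (i (Inr \<gamma>))) = cmp \<Delta> (F (i (Inl \<eta>))) (F (j y))"
    if "x \<in> carrier X" "\<gamma> \<in> mor \<Gamma>" "msrc X x = rng \<Gamma> \<gamma>" "phi X (x, \<gamma>) = (\<eta>, y)" for x \<gamma> \<eta> y
    using cmp_j[OF that] phiD[OF that] that
    by (simp add: Sigma_simps flip: F(6))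
  ultimately show ?thesis
    by unfold_locales (auto simp: F i_mor j_mor rng_j src_j)
qed

end

section \<open>Existence and uniqueness of linking graphs\<close>

context graph_morph
begin

text \<open>An element x corresponds to the bridge whose \<Lambda>-part is the identity r(x);
  cancelling \<open>gen k\<close> shows that every path of degree \<open>gen k\<close> has this
  form.\<close>

lemma linking_link_graph:
  "linking k \<Lambda> \<Gamma> X (link_graph k \<Lambda> \<Gamma> X) (case_sum Lft Rgt) (\<lambda>x. Bridge (mrng X x) x)"
proof -
  let ?C = "link_graph k \<Lambda> \<Gamma> X" and ?i = "case_sum Lft Rgt" and ?j = "\<lambda>x. Bridge (mrng X x) x"
  interpret S: k_graph "Suc k" ?C by (rule k_graph_link)
  have grade: "f \<in> grade ?C (gen k) \<longleftrightarrow> (\<exists>x\<in>carrier X. f = ?j x)" for f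
  proof
    assume f: "f \<in> grade ?C (gen k)"
    then have m: "f \<in> mor ?C" and d: "deg ?C f = gen k" by (simp_all add: grade_def)
    from deg_link_top[OF m] obtain \<eta> x where e: "f = Bridge \<eta> x"
      unfolding d by (cases f) auto
    with m d have "\<eta> \<in> grade \<Lambda> 0" by (simp add: grade_def)
    then show "\<exists>x\<in>carrier X. f = ?j x" using e m L.vertexD by auto
  qed (auto simp: grade_def)
  have "bij_betw ?i (mor (graph_sum \<Lambda> \<Gamma>)) {f \<in> mor ?C. deg ?C f \<in> Nat_pow k}"
    unfolding bij_betw_def
  proof (intro conjI equalityI subsetI)
    fix f assume "f \<in> {f \<in> mor ?C. deg ?C f \<in> Nat_pow k}"
    then show "f \<in> ?i ` mor (graph_sum \<Lambda> \<Gamma>)"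
      using deg_link_top[of f] Nat_pow_top[of "deg ?C f" k]
      by (cases f) (auto simp: graph_sum_def image_iff Bex_def split: sum.splits)
  qed (auto simp: graph_sum_def inj_on_def L.deg_Nat_pow G.deg_Nat_pow)
  moreover have "bij_betw ?j (carrier X) (grade ?C (gen k))"
    by (auto simp: bij_betw_def inj_on_def grade)
  moreover have "is_functor (graph_sum \<Lambda> \<Gamma>) ?C ?i"
    by (auto simp: is_functor_def graph_sum_def)
  moreover have "src ?C f \<in> ?i ` Inr ` grade \<Gamma> 0 \<and> rng ?C f \<in> ?i ` Inl ` grade \<Lambda> 0"
    if "f \<in> grade ?C (gen k)" for f
    using that mrng_vertex msrc_vertex by (auto simp: grade image_image)
  \<comment> \<open>By the unit laws in \<Lambda>, both sides reduce to
    \<open>Bridge \<eta> y\<close>.\<close>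
  moreover have "cmp ?C (?j x) (?i (Inr \<gamma>)) = cmp ?C (?i (Inl \<eta>)) (?j y)"
    if "x \<in> carrier X" "\<gamma> \<in> mor \<Gamma>" "msrc X x = rng \<Gamma> \<gamma>" "phi X (x, \<gamma>) = (\<eta>, y)" for x \<gamma> \<eta> y
    using phiD[OF that] that L.cmp_rng[of \<eta>] L.cmp_src[of \<eta>] by simp
  ultimately show ?thesis
    by unfold_locales (auto simp: graph_sum_def)
qed

lemma link_graph_iso:
  assumes "linking_graph k \<Lambda> \<Gamma> X \<Sigma> i"
  obtains F where "graph_iso (link_graph k \<Lambda> \<Gamma> X) \<Sigma> F"
  using assms linking.graph_iso_comparison
  unfolding linking_graph_iff_linking[OF L.k_graph_axioms G.k_graph_axioms k_morph_axioms]
  by blast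

end

theorem proposition4p5:
  fixes k :: nat
    and \<Lambda> :: "'a graph" and \<Gamma> :: "'b graph"
    and X :: "('x, 'a, 'b) morph"
  assumes "k_graph k \<Lambda>" and "k_graph k \<Gamma>" and "k_morph \<Lambda> \<Gamma> X"
  shows "(\<exists>(\<Sigma> :: nat graph) i. linking_graph k \<Lambda> \<Gamma> X \<Sigma> i) \<and>
    (\<forall>(\<Sigma>\<^sub>1 :: 'c graph) i\<^sub>1 (\<Sigma>\<^sub>2 :: 'd graph) i\<^sub>2.
      linking_graph k \<Lambda> \<Gamma> X \<Sigma>\<^sub>1 i\<^sub>1 \<and> linking_graph k \<Lambda> \<Gamma> X \<Sigma>\<^sub>2 i\<^sub>2 \<longrightarrow>
      (\<exists>F. graph_iso \<Sigma>\<^sub>1 \<Sigma>\<^sub>2 F))"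
proof -
  interpret graph_morph k \<Lambda> \<Gamma> X by (intro graph_morph.intro assms)
  let ?C = "link_graph k \<Lambda> \<Gamma> X"
  \<comment> \<open>Countability of the canonical model gives the injection along which it is
    relabelled.\<close>
  have "inj_on (to_nat_on (mor ?C)) (mor ?C)"
    by (rule inj_on_to_nat_on[OF k_graph.countable_mor[OF k_graph_link]])
  then have "\<exists>(\<Sigma> :: nat graph) i. linking_graph k \<Lambda> \<Gamma> X \<Sigma> i"
    using linking.linking_transport[OF linking_link_graph] relabel[OF k_graph_link]
    unfolding linking_graph_iff_linking[OF assms] by blast
  moreover have "\<exists>F. graph_iso \<Sigma>\<^sub>1 \<Sigma>\<^sub>2 F"
    if links: "linking_graph k \<Lambda> \<Gamma> X \<Sigma>\<^sub>1 i\<^sub>1" "linking_graph k \<Lambda> \<Gamma> X \<Sigma>\<^sub>2 i\<^sub>2"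
    for \<Sigma>\<^sub>1 :: "'c graph" and i\<^sub>1 and \<Sigma>\<^sub>2 :: "'d graph" and i\<^sub>2
  proof -
    \<comment> \<open>The isomorphism passes through the canonical model: the inverse of
      \<open>F\<close> followed by \<open>G\<close>.\<close>
    obtain F G where "graph_iso ?C \<Sigma>\<^sub>1 F" "graph_iso ?C \<Sigma>\<^sub>2 G"
      using link_graph_iso[OF links(1)] link_graph_iso[OF links(2)] by metis
    then show ?thesis using graph_iso_comp graph_iso_inv[OF small_category_link] by blast
  qed
  ultimately show ?thesis by blast
qed

end
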